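(* Let $k\ge 4$ and $\nu\ge 0$ be fixed integers. There exist two constants $c'_1,c'_2\ge k\left\lfloor\frac{\nu^2}{4}\right\rfloor$ (depending only on $k$ and $\nu$, not on $n$) such that \[ f(n,k,4,\nu) \ge \binom{n-k\nu-1}{k-1}+c'_1\binom{n-k\nu-1}{k-3} \] holds for all $n$ (with $n\ge k(\nu+1)$), and \[ f(n,k,4,\nu)\le\binom{n-k\nu-1}{k-1}+c'_2\binom{n-k\nu-1}{k-3} \] holds for all sufficiently large $n$. In particular, if $\nu=1$, then \[ f(n,k,4,1)\ge \binom{n-k-1}{k-1}+ex(n-k-1,P_{2}^{k-2})+1 \] holds for all $n$ (with $n\ge 2k$).
   Context: $[n]=\{1,\dots,n\}$, and $\binom{V}{k}$ is the collection of all $k$-element subsets of a set $V$. A $d$-cluster of $k$-sets is a collection of $d$ different $k$-sets $A_1,\dots,A_d$ with $|A_1\cup\dots\cup A_d|\le 2k$ and $A_1\cap\dots\cap A_d=\emptyset$. A family $\mathcal{F}\subset\binom{[n]}{k}$ is $d$-cluster-free if it contains no $d$-cluster. The matching number $\nu(\mathcal{F})$ is the maximum number of pairwise disjoint sets in $\mathcal{F}$. For $n\ge k(\nu+1)$, $f(n,k,d,\nu)$ is the maximum size of a $d$-cluster-free family $\mathcal{F}\subset\binom{[n]}{k}$ with $\nu(\mathcal{F})\ge\nu+1$. An $r$-graph is an $r$-uniform hypergraph without multiple edges. The tight $\ell$-path $P_{\ell}^{r}$ is the $r$-graph with edge set $\{v_iv_{i+1}\dots v_{i+r-1}:1\le i\le\ell\}$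 (with $v_1,\dots,v_{\ell+r-1}$ distinct); so $P_2^{r}$ consists of two $r$-sets sharing exactly $r-1$ vertices. $ex(n,P_{\ell}^{r})$ is the maximum number of edges in an $n$-vertex $r$-graph containing no copy of $P_{\ell}^{r}$ as a subgraph. *)

theory Defs
  imports Complex_Main "HOL-Library.Ramsey"
begin

(* The collection of k-element subsets of V is Ramsey's [V]\<^bsup>k\<^esup> (constant nsets). *)

definition d_cluster :: "nat \<Rightarrow> nat \<Rightarrow> 'a set set \<Rightarrow> bool" where
  "d_cluster d k C \<longleftrightarrow>
     finite C \<and> card C = d \<and> C \<subseteq> [UNIV]\<^bsup>k\<^esup> \<and> card (\<Union>C) \<le> 2 * k \<and> \<Inter>C = {}"

definition d_cluster_free :: "nat \<Rightarrow> nat \<Rightarrow> 'a set set \<Rightarrow> bool" where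
  "d_cluster_free d k F \<longleftrightarrow> \<not> (\<exists>C\<subseteq>F. d_cluster d k C)"

(* Intended for finite families F. *)
definition matching_number :: "'a set set \<Rightarrow> nat" where
  "matching_number F = Max {card M | M. M \<subseteq> F \<and> pairwise disjnt M}"

(* Meaningful only when some admissible family exists; for d = 4 and k \<ge> 4 the condition
   k * (\<nu> + 1) \<le> n ensures this, as \<nu> + 1 pairwise disjoint k-sets contain no 4-cluster. *)
definition max_cluster_free :: "nat \<Rightarrow> nat \<Rightarrow> nat \<Rightarrow> nat \<Rightarrow> nat" where
  "max_cluster_free n k d \<nu> =
     Max {card F | F. F \<subseteq> [{1..n}]\<^bsup>k\<^esup> \<and> d_cluster_free d k F \<and> \<nu> + 1 \<le> matching_number F}"

(* P is the edge set of a copy of the tight l-path: the r-graph on the distinct vertices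
   v 1, ..., v (l + r - 1) with edges {v i, ..., v (i + r - 1)} for 1 \<le> i \<le> l. *)
definition is_tight_path :: "nat \<Rightarrow> nat \<Rightarrow> 'a set set \<Rightarrow> bool" where
  "is_tight_path l r P \<longleftrightarrow>
     (\<exists>v :: nat \<Rightarrow> 'a. inj_on v {1..<l + r} \<and> P = {v ` {i..<i + r} | i. 1 \<le> i \<and> i \<le> l})"

(* The Turan number ex(m, P) for P the tight l-path of uniformity r.  An r-graph on m vertices
   is represented by its edge set on the vertex set {1..m}; for r \<ge> 1 a tight path has no isolated
   vertices, so containing a copy of it depends on the edge sets only. *)
definition ex_tight_path :: "nat \<Rightarrow> nat \<Rightarrow> nat \<Rightarrow> nat" where
  "ex_tight_path m l r =
     Max {card H | H. H \<subseteq> [{1..m}]\<^bsup>r\<^esup> \<and> \<not> (\<exists>P\<subseteq>H. is_tight_path l r P)}"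

end

(*
Upper bound.  Let F be 4-cluster-free on n points.  If A, A' in F meet in exactly {d, d'} and
both A - d and A - d' lie in further members of F, these four sets form a cluster.  Call v an
own vertex of A if no other member contains A - v.  Members without own vertices never meet in
exactly two points, so there are only O(n^(k-2)) of them; as distinct pairs (A, v) have distinct
A - v, a family with C(n,k-1) - O(n^(k-2)) members has, up to O(n^(k-2)) exceptions, exactly one
own vertex in each member, and nearly all (k-1)-sets arise as A minus its own vertex.  For a
typical pair d, a the members with d, a among their other vertices pairwise share a third
vertex, hence all share a vertex x.  If nearly all sets D + h with D = {x, d, a} are present,
only O(n) members avoid D; this makes x the centre of all but O(n^(k-2)) members, and the same
argument with D = {x} improves this to all but O(n).
Finally let B_1, ..., B_nu be disjoint members avoiding x, and let U be the set of the remaining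
m points.  If {x, b, y} + f and {x, b', y'} + f are members with b, b' in B_i and f + y + y'
contained in U, then {x, y, y'} + f is missing; so all members through x that meet the blocks are paid
for by the missing ones, up to O(n^(k-3)).

Lower bounds.  Take the star of x on x and U together with nu disjoint blocks, and add sets
through x that meet the blocks in a controlled way.

Throughout, |X| = O(n^(k-t)) is written card X * n^t <= C * n^k, which needs no subtraction.
*)

theory Submission
  imports Defs
begin

text \<open>For k = 4 the error term binom(n-k*nu-1, k-3) is only linear in n. A bound O(n^(k-2)) on
  the members avoiding the centre is then too weak, and for this reason the blocking argument runs
  twice. It requires that among all sets D + h only a fraction O(1/n) is missing. For D = {x}
  nothing of the kind is known at the outset, but averaging provides it for a triple: O(n^(k-2))
  uncovered (k-1)-sets leave some pair d, a that lies in only O(n^(k-4)) of them, out of about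
  n^(k-3), and the third vertex x completes D. The same averaging keeps rare the members whose own
  vertex is d or a; this controls the members that avoid x but meet {d, a}.

  In the construction, blocks of different halves form a complete bipartite graph. Its floor(nu^2/4)
  edges times the k positions give the constant. The partners of one block all lie in the opposite
  half, so two of them never form a permitted pair.\<close>

section \<open>Counting with powers of n in place of binomials\<close>

lemma card_UN_mult_le:
  fixes a b :: nat
  assumes "finite I" "\<And>i. i \<in> I \<Longrightarrow> card (X i) * a \<le> b"
  shows "card (\<Union>i\<in>I. X i) * a \<le> card I * b"
proof -
  have "card (\<Union>i\<in>I. X i) * a \<le> (\<Sum>i\<in>I. card (X i)) * a"
    using card_UN_le[OF assms(1), of X] by simp
  also have "\<dots> = (\<Sum>i\<in>I. card (X i) * a)" by (simp add: sum_distrib_right)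
  also have "\<dots> \<le> card I * b" using sum_bounded_above[of I "\<lambda>i. card (X i) * a" b] assms by simp
  finally show ?thesis .
qed

lemma card_filter_split:
  assumes "finite F"
  shows "card F = card {B \<in> F. P B} + card {B \<in> F. \<not> P B}"
proof -
  have "card F = card ({B \<in> F. P B} \<union> {B \<in> F. \<not> P B})"
    by (rule arg_cong[where f = card]) blast
  also have "\<dots> = card {B \<in> F. P B} + card {B \<in> F. \<not> P B}"
    by (rule card_Un_disjoint) (use assms in auto)
  finally show ?thesis .
qed

lemma binomial_le_power: "n choose r \<le> n ^ r"
  by (cases "r \<le> n") (auto simp: binomial_le_pow binomial_eq_0)

text \<open>A set through T is determined by its k - card T remaining points. T is arbitrary: if no
  k-subset of V contains it, the left side vanishes.\<close>

lemma card_nsets_supset_le: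
  assumes "finite V"
  shows "card {A \<in> [V]\<^bsup>k\<^esup>. T \<subseteq> A} * card V ^ card T \<le> card V ^ k"
proof (cases "\<exists>A \<in> [V]\<^bsup>k\<^esup>. T \<subseteq> A")
  case False
  then have "{A \<in> [V]\<^bsup>k\<^esup>. T \<subseteq> A} = {}" by blast
  then show ?thesis by (simp only: card.empty)
next
  case True
  then obtain A where A: "A \<in> [V]\<^bsup>k\<^esup>" "T \<subseteq> A" by blast
  then have T: "finite T" "card T \<le> k" "T \<subseteq> V"
    by (auto simp: nsets_def intro: finite_subset card_mono)
  have "card {A \<in> [V]\<^bsup>k\<^esup>. T \<subseteq> A} \<le> card ([V]\<^bsup>(k - card T)\<^esup>)"
  proof (rule card_inj_on_le[where f = "\<lambda>A. A - T"])
    show "inj_on (\<lambda>A. A - T) {A \<in> [V]\<^bsup>k\<^esup>. T \<subseteq> A}" by (auto simp: inj_on_def)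
    show "(\<lambda>A. A - T) ` {A \<in> [V]\<^bsup>k\<^esup>. T \<subseteq> A} \<subseteq> [V]\<^bsup>(k - card T)\<^esup>"
      using T by (auto simp: nsets_def card_Diff_subset)
  qed (use assms in \<open>simp add: finite_imp_finite_nsets\<close>)
  also have "\<dots> \<le> card V ^ (k - card T)" by (simp add: binomial_le_power)
  finally have "card {A \<in> [V]\<^bsup>k\<^esup>. T \<subseteq> A} * card V ^ card T \<le> card V ^ (k - card T) * card V ^ card T"
    by simp
  also have "\<dots> = card V ^ k" using T by (simp flip: power_add)
  finally show ?thesis .
qed

text \<open>Since n - c is at least n/2 and j is at most k, the quotient (n - c)/j is at least
  n/(2k). This is the source of the factors (2k)^k in the constants below.\<close>

lemma power_le_binomial:
  assumes "2 * c \<le> n" "c + j \<le> n" "j \<le> k"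
  shows "n ^ j \<le> (2 * k) ^ j * ((n - c) choose j)"
proof (cases "j = 0")
  case False
  have "real n / real (2 * k) \<le> real (n - c) / real j"
  proof -
    have "real n * real j \<le> (2 * real (n - c)) * real k"
      using assms by (intro mult_mono) linarith+
    then show ?thesis using False assms by (simp add: field_simps)
  qed
  then have "(real n / real (2 * k)) ^ j \<le> (real (n - c) / real j) ^ j"
    by (intro power_mono) auto
  also have "\<dots> \<le> real ((n - c) choose j)"
    using binomial_ge_n_over_k_pow_k[of j "n - c", where 'a = real] assms by simp
  finally have "real n ^ j \<le> real (2 * k) ^ j * real ((n - c) choose j)"
    using False assms by (simp add: power_divide field_simps)
  then have "real (n ^ j) \<le> real ((2 * k) ^ j * ((n - c) choose j))" by simp
  then show ?thesis by (simp only: of_nat_le_iff)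
qed auto

text \<open>Lowering the upper index by one costs at most n^j by Pascal's rule. This compares all
  (k-1)-sets with those of the smaller star.\<close>

lemma binomial_diff_le:
  "n choose Suc j \<le> ((n - c) choose Suc j) + c * n ^ j"
proof (induction c)
  case (Suc c)
  have "(n - c) choose Suc j \<le> ((n - Suc c) choose Suc j) + n ^ j"
  proof (cases "n - c")
    case (Suc m)
    then have "m choose j \<le> n ^ j" using binomial_le_power[of m j] power_mono[of m n j] by linarith
    moreover have "n - Suc c = m" using Suc by simp
    ultimately show ?thesis using Suc by simp
  qed auto
  then show ?case using Suc by simp
qed simp

lemma four_sets_cluster_freeD:
  assumes "d_cluster_free 4 k F" "B \<in> F" "A1 \<in> F" "A2 \<in> F" "A3 \<in> F" "F \<subseteq> [V]\<^bsup>k\<^esup>"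
    "distinct [B, A1, A2, A3]" "B \<inter> A1 \<inter> A2 \<inter> A3 = {}" "card (B \<union> A1 \<union> A2 \<union> A3) \<le> 2 * k"
  shows False
proof -
  have "{B, A1, A2, A3} \<subseteq> F" using assms by auto
  moreover have "F \<subseteq> [UNIV]\<^bsup>k\<^esup>" using assms nsets_mono[of V UNIV k] by blast
  ultimately have sub: "{B, A1, A2, A3} \<subseteq> [UNIV]\<^bsup>k\<^esup>" by (rule subset_trans)
  have "card {B, A1, A2, A3} = 4" using assms(7) by simp
  moreover have "\<Union>{B, A1, A2, A3} = B \<union> A1 \<union> A2 \<union> A3" by blast
  moreover have "\<Inter>{B, A1, A2, A3} = B \<inter> A1 \<inter> A2 \<inter> A3" by blast
  ultimately have "d_cluster 4 k {B, A1, A2, A3}"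
    using sub assms(8,9) unfolding d_cluster_def by (simp only: finite.emptyI finite.insertI)
  then show False using \<open>{B, A1, A2, A3} \<subseteq> F\<close> assms(1) unfolding d_cluster_free_def by blast
qed

text \<open>Up to y = 2T the constant term pays; beyond that y - 1 is at least 2T, so there are at
  least T * y pairs.\<close>

lemma mult_le_choose_two: "T * y \<le> 2 * T\<^sup>2 + (y choose 2)" for T y :: nat
proof (cases "y \<le> 2 * T")
  case True
  then have "T * y \<le> T * (2 * T)" by (rule mult_le_mono2)
  also have "\<dots> \<le> 2 * T\<^sup>2 + (y choose 2)" by (simp add: power2_eq_square)
  finally show ?thesis .
next
  case False
  then have "y * (2 * T) \<le> y * (y - 1)" by (intro mult_le_mono2) simp
  then have "y * (2 * T) div 2 \<le> y choose 2" unfolding choose_two by (rule div_le_mono)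
  then show ?thesis by (simp add: mult.commute)
qed

section \<open>Families with restricted intersections\<close>

lemma nsets_exchangeE:
  assumes "A \<in> [V]\<^bsup>k\<^esup>" "C \<in> [V]\<^bsup>k\<^esup>" "d \<in> A" "A - {d} \<subseteq> C" "C \<noteq> A"
  obtains y where "y \<notin> A" "C = insert y (A - {d})"
proof -
  have fin: "finite A" "finite C" "card A = k" "card C = k" using assms by (auto simp: nsets_def)
  have "card (C - (A - {d})) = 1"
    using fin assms(3,4) card_gt_0_iff[of A] by (subst card_Diff_subset) auto
  then obtain y where y: "C - (A - {d}) = {y}" by (auto simp: card_1_singleton_iff)
  then have C: "C = insert y (A - {d})" using assms(4) by blast
  moreover have "y \<notin> A" using y C assms(3,5) by auto
  ultimately show thesis using that by blast
qed

lemma cluster_if_intersection_two: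
  assumes F: "d_cluster_free 4 k F" "F \<subseteq> [V]\<^bsup>k\<^esup>" and "k \<ge> 4"
    and A: "A \<in> F" "A' \<in> F" "A \<inter> A' = {d, d'}" "d \<noteq> d'"
    and C: "C \<in> F" "A - {d} \<subseteq> C" "C \<noteq> A"
    and C': "C' \<in> F" "A - {d'} \<subseteq> C'" "C' \<noteq> A"
  shows False
proof -
  have sets: "A \<in> [V]\<^bsup>k\<^esup>" "A' \<in> [V]\<^bsup>k\<^esup>" "C \<in> [V]\<^bsup>k\<^esup>" "C' \<in> [V]\<^bsup>k\<^esup>" using assms by auto
  then have fin: "finite A" "finite A'" and card: "card A = k" "card A' = k" by (auto simp: nsets_def)
  have d: "d \<in> A" "d' \<in> A" using A by auto
  obtain y where y: "y \<notin> A" "C = insert y (A - {d})" using nsets_exchangeE sets d C by metis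
  obtain y' where y': "y' \<notin> A" "C' = insert y' (A - {d'})" using nsets_exchangeE sets d C' by metis
  \<comment> \<open>A' meets A in two points only, whereas C and C' meet A in k - 1, that is, in at
    least three.\<close>
  have far: "A' \<noteq> X" if "card (A \<inter> X) \<ge> 3" for X using that A(3,4) by (auto simp: card_insert_if)
  have "A \<inter> C = A - {d}" "A \<inter> C' = A - {d'}" using y y' by auto
  then have "A' \<noteq> A" "A' \<noteq> C" "A' \<noteq> C'" using far \<open>k \<ge> 4\<close> card d by (auto intro!: far)
  moreover have "C \<noteq> C'" using y y' d A(4) by auto
  ultimately have dist: "distinct [A, A', C, C']" using C C' by auto
  have "d \<notin> C" "d' \<notin> C'" using y y' d by auto
  then have int: "A \<inter> A' \<inter> C \<inter> C' = {}" using A(3) by auto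
  have "card (A \<union> A') = 2 * k - 2"
    using card_Un_Int[OF fin] card A(3,4) \<open>k \<ge> 4\<close> by simp
  \<comment> \<open>A and A' cover 2k - 2 points; C and C' add at most y and y', which stays just
    within 2k.\<close>
  moreover have "A \<union> A' \<union> C \<union> C' \<subseteq> insert y (insert y' (A \<union> A'))" using y y' by auto
  then have "card (A \<union> A' \<union> C \<union> C') \<le> card (insert y (insert y' (A \<union> A')))"
    by (rule card_mono[rotated]) (use fin in simp)
  moreover have "card (insert y (insert y' (A \<union> A'))) \<le> card (A \<union> A') + 2"
    using fin by (simp add: card_insert_if)
  ultimately have "card (A \<union> A' \<union> C \<union> C') \<le> 2 * k" using \<open>k \<ge> 4\<close> by linarith
  then show False using four_sets_cluster_freeD[OF F(1) A(1,2) C(1) C'(1) F(2) dist int] by simp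
qed

text \<open>Any two sets of E share a third vertex v besides a, b. If no such v is common to all,
  fix one set \<open>A0\<close> and for each v a set \<open>avoid v\<close> of E missing v. Every A
  in E meets \<open>A0\<close> in some v and \<open>avoid v\<close> in some u different from a, b,
  v, so A contains one of at most k^2 quadruples {a, b, v, u}.\<close>

lemma common_vertex_or_few:
  assumes "finite V" "E \<subseteq> [V]\<^bsup>k\<^esup>" "a \<noteq> b" "\<And>A. A \<in> E \<Longrightarrow> a \<in> A \<and> b \<in> A"
    and "\<And>A A'. A \<in> E \<Longrightarrow> A' \<in> E \<Longrightarrow> card (A \<inter> A') \<noteq> 2"
  shows "(\<exists>x. x \<noteq> a \<and> x \<noteq> b \<and> (\<forall>A\<in>E. x \<in> A)) \<or> card E * card V ^ 4 \<le> k\<^sup>2 * card V ^ k"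
proof (subst disj_commute, rule disjCI)
  assume "\<not> (\<exists>x. x \<noteq> a \<and> x \<noteq> b \<and> (\<forall>A\<in>E. x \<in> A))"
  then have "\<exists>A\<in>E. x \<noteq> a \<longrightarrow> x \<noteq> b \<longrightarrow> x \<notin> A" if "E \<noteq> {}" for x using that by blast
  then obtain avoid where avoid: "avoid x \<in> E" "x \<noteq> a \<Longrightarrow> x \<noteq> b \<Longrightarrow> x \<notin> avoid x" if "E \<noteq> {}" for x
    by metis
  have third: "\<exists>v \<in> A \<inter> A'. v \<noteq> a \<and> v \<noteq> b" if "A \<in> E" "A' \<in> E" for A A'
  proof (rule ccontr)
    assume "\<not> ?thesis"
    then have "A \<inter> A' = {a, b}" using assms(4) that by auto
    then have "card (A \<inter> A') = 2" using assms(3) by simp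
    then show False using assms(5) that by blast
  qed
  have fin: "finite A" "card A = k" if "A \<in> E" for A using that assms(2) by (auto simp: nsets_def)
  show "card E * card V ^ 4 \<le> k\<^sup>2 * card V ^ k"
  proof (cases "E = {}")
    case False
    then obtain A0 where A0: "A0 \<in> E" by blast
    define I where "I = (SIGMA v: A0 - {a, b}. avoid v - {a, b, v})"
    have I: "finite I" "card I \<le> k * k"
    proof -
      show "finite I" unfolding I_def using fin A0 avoid(1)[OF False] by auto
      have "card I \<le> card (SIGMA v: A0. avoid v)"
        unfolding I_def using fin A0 avoid(1)[OF False] by (intro card_mono) auto
      also have "\<dots> = k * k" using fin A0 avoid(1)[OF False] by (subst card_SigmaI) auto
      finally show "card I \<le> k * k" .
    qed
    have "E \<subseteq> (\<Union>(v, u)\<in>I. {A \<in> [V]\<^bsup>k\<^esup>. {a, b, v, u} \<subseteq> A})"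
    proof
      fix A assume A: "A \<in> E"
      obtain v where v: "v \<in> A \<inter> A0" "v \<noteq> a" "v \<noteq> b" using third A A0 by blast
      obtain u where u: "u \<in> A \<inter> avoid v" "u \<noteq> a" "u \<noteq> b" using third A avoid(1)[OF False] by blast
      have "u \<noteq> v" using u v avoid(2)[OF False] by auto
      then have "(v, u) \<in> I" "A \<in> {A \<in> [V]\<^bsup>k\<^esup>. {a, b, v, u} \<subseteq> A}"
        using u v A assms(2,4) by (auto simp: I_def)
      then show "A \<in> (\<Union>(v, u)\<in>I. {A \<in> [V]\<^bsup>k\<^esup>. {a, b, v, u} \<subseteq> A})" by blast
    qed
    then have "card E \<le> card (\<Union>(v, u)\<in>I. {A \<in> [V]\<^bsup>k\<^esup>. {a, b, v, u} \<subseteq> A})"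
      by (rule card_mono[rotated]) (use I assms(1) in \<open>auto simp: finite_imp_finite_nsets\<close>)
    then have "card E * card V ^ 4 \<le> card (\<Union>(v, u)\<in>I. {A \<in> [V]\<^bsup>k\<^esup>. {a, b, v, u} \<subseteq> A}) * card V ^ 4"
      by simp
    also have "\<dots> \<le> card I * card V ^ k"
    proof (rule card_UN_mult_le[OF I(1)], clarify)
      fix v u assume "(v, u) \<in> I"
      then have "card {a, b, v, u} = 4" using assms(3) by (auto simp: I_def card_insert_if)
      then show "card {A \<in> [V]\<^bsup>k\<^esup>. {a, b, v, u} \<subseteq> A} * card V ^ 4 \<le> card V ^ k"
        using card_nsets_supset_le[OF assms(1), of k "{a, b, v, u}"] by (simp only:)
    qed
    also have "\<dots> \<le> k\<^sup>2 * card V ^ k" using I by (simp add: power2_eq_square)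
    finally show ?thesis .
  qed auto
qed

text \<open>If many sets contain a pair $a, b$, their intersection \<open>cl a b\<close> has exactly three points.  When all
  pairs in $A$ are of this kind, two such triples meeting in one point give five points of $A$ that are
  determined by three of them.\<close>

lemma no_intersection_two_bound:
  assumes "finite V" "E \<subseteq> [V]\<^bsup>k\<^esup>" "k \<ge> 4"
    and E: "\<And>A A'. A \<in> E \<Longrightarrow> A' \<in> E \<Longrightarrow> card (A \<inter> A') \<noteq> 2"
  shows "card E * card V ^ 2 \<le> (k\<^sup>2 + 1) * card V ^ k"
proof -
  let ?n = "card V"
  have fin: "finite A" "card A = k" "A \<subseteq> V" if "A \<in> E" for A using that assms(2) by (auto simp: nsets_def)
  define P where "P a b = {A \<in> E. a \<in> A \<and> b \<in> A}" for a b
  define cl where "cl a b = \<Inter>(P a b)" for a b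
  \<comment> \<open>A pair is light when it satisfies the second alternative of
    \<open>common_vertex_or_few\<close>; every other pair has a third common vertex.\<close>
  define light where "light a b \<longleftrightarrow> card (P a b) * ?n ^ 4 \<le> k\<^sup>2 * ?n ^ k" for a b
  define L where "L = (\<Union>(a, b)\<in>{(a, b) \<in> V \<times> V. light a b}. P a b)"
  define T where "T = {(a, b, e) \<in> V \<times> V \<times> V. card (cl a b \<union> cl a e) = 5}"
  define H where "H = (\<Union>(a, b, e)\<in>T. {A \<in> [V]\<^bsup>k\<^esup>. cl a b \<union> cl a e \<subseteq> A})"
  have finE: "finite E" using assms(1,2) by (meson finite_subset finite_imp_finite_nsets)
  have P_sub: "P a b \<subseteq> [V]\<^bsup>k\<^esup>" for a b using assms(2) by (auto simp: P_def)
  have card_cl: "card (cl a b) = 3"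
    if "\<not> light a b" "a \<noteq> b" "A \<in> E" "a \<in> A" "b \<in> A" for a b A
  proof -
    have sub: "cl a b \<subseteq> A" using that by (auto simp: cl_def P_def)
    then have fincl: "finite (cl a b)" using fin that by (auto intro: finite_subset)
    obtain x where "x \<noteq> a" "x \<noteq> b" "\<forall>A\<in>P a b. x \<in> A"
    proof -
      note obt = that
      have "(\<exists>x. x \<noteq> a \<and> x \<noteq> b \<and> (\<forall>A\<in>P a b. x \<in> A)) \<or> card (P a b) * ?n ^ 4 \<le> k\<^sup>2 * ?n ^ k"
        using \<open>a \<noteq> b\<close> E by (intro common_vertex_or_few[OF assms(1) P_sub]) (auto simp: P_def)
      then show thesis using \<open>\<not> light a b\<close> obt by (auto simp: light_def)
    qed
    then have "{a, b, x} \<subseteq> cl a b" "card {a, b, x} = 3" using that by (auto simp: cl_def P_def)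
    then have "3 \<le> card (cl a b)" using fincl by (metis card_mono)
    \<comment> \<open>Four common points would confine \<open>P a b\<close> to n^(k-4) sets and make
      the pair light.\<close>
    moreover have "card (cl a b) < 4"
    proof (rule ccontr)
      assume "\<not> card (cl a b) < 4"
      then obtain Z where Z: "Z \<subseteq> cl a b" "card Z = 4" by (metis not_less obtain_subset_with_card_n)
      have "P a b \<subseteq> {A \<in> [V]\<^bsup>k\<^esup>. Z \<subseteq> A}" using Z P_sub[of a b] by (auto simp: cl_def)
      then have "card (P a b) \<le> card {A \<in> [V]\<^bsup>k\<^esup>. Z \<subseteq> A}"
        using assms(1) by (intro card_mono) (auto simp: finite_imp_finite_nsets)
      then have "card (P a b) * ?n ^ 4 \<le> card {A \<in> [V]\<^bsup>k\<^esup>. Z \<subseteq> A} * ?n ^ 4" by simp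
      also have "\<dots> \<le> ?n ^ k" using card_nsets_supset_le[OF assms(1), of k Z] Z by simp
      also have "\<dots> \<le> k\<^sup>2 * ?n ^ k" using assms(3) by simp
      finally show False using that by (simp add: light_def)
    qed
    ultimately show ?thesis by simp
  qed
  have "E \<subseteq> L \<union> H"
  proof
    fix A assume A: "A \<in> E"
    show "A \<in> L \<union> H"
    proof (cases "\<exists>a\<in>A. \<exists>b\<in>A. light a b")
      case True
      then obtain a b where ab: "a \<in> A" "b \<in> A" "light a b" by blast
      then have "(a, b) \<in> {(a, b) \<in> V \<times> V. light a b}" "A \<in> P a b"
        using A fin(3)[OF A] by (auto simp: P_def)
      then have "A \<in> L" unfolding L_def by blast
      then show ?thesis by simp
    next
      case False
      have cl3: "card (cl a b) = 3" "cl a b \<subseteq> A" "a \<in> cl a b" "b \<in> cl a b"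
        if "a \<in> A" "b \<in> A" "a \<noteq> b" for a b
        using card_cl[of a b A] that False A by (auto simp: cl_def P_def)
      have mono: "cl c d \<subseteq> cl a b" if "c \<in> cl a b" "d \<in> cl a b" for a b c d
        using that by (auto simp: cl_def P_def)
      \<comment> \<open>Any two points of a triple determine it: \<open>cl c d\<close> lies inside
        \<open>cl a b\<close> and has three points as well. Triples inside A thus behave like lines,
        and distinct ones share at most one point.\<close>
      have same: "cl c d = cl a b"
        if "c \<in> cl a b" "d \<in> cl a b" "c \<noteq> d" "a \<in> A" "b \<in> A" "a \<noteq> b" for a b c d
      proof -
        have "c \<in> A" "d \<in> A" using cl3[of a b] that by auto
        then show ?thesis using cl3[of a b] cl3[of c d] mono[of c a b d] that
          by (metis card_subset_eq card.infinite zero_neq_numeral)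
      qed
      have "\<not> A \<subseteq> {}" using fin(2)[OF A] assms(3) by auto
      then obtain a where a: "a \<in> A" by blast
      have "\<not> A \<subseteq> {a}" using fin(2)[OF A] card_mono[of "{a}" A] assms(3) by auto
      then obtain b where b: "b \<in> A" "b \<noteq> a" by blast
      have "finite (cl a b)" using cl3(1)[OF a b(1)] b(2) by (metis card.infinite zero_neq_numeral)
      then have "\<not> A \<subseteq> cl a b" using fin(2)[OF A] card_mono[of "cl a b" A] cl3(1)[OF a b(1)] b(2) assms(3) by auto
      then obtain e where e: "e \<in> A" "e \<notin> cl a b" by blast
      have ae: "a \<noteq> e" using e cl3[OF a b(1)] b(2) by auto
      then have "finite (cl a e)" using cl3(1)[OF a e(1)] by (metis card.infinite zero_neq_numeral)
      have "cl a b \<inter> cl a e = {a}"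
      proof (rule ccontr)
        assume "cl a b \<inter> cl a e \<noteq> {a}"
        moreover have "a \<in> cl a b" "a \<in> cl a e" using cl3(3) a b e ae by auto
        ultimately obtain f where f: "f \<in> cl a b" "f \<in> cl a e" "f \<noteq> a" by blast
        then have "cl a f = cl a b" "cl a f = cl a e"
          using same[of a a b f] same[of a a e f] a b e ae cl3[OF a b(1)] cl3[OF a e(1) ae] by auto
        then show False using e cl3[OF a e(1) ae] by auto
      qed
      then have "card (cl a b \<union> cl a e) = 5"
        using card_Un_Int[OF \<open>finite (cl a b)\<close> \<open>finite (cl a e)\<close>] cl3(1)[OF a b(1)] cl3(1)[OF a e(1) ae] b(2)
        by simp
      then have "(a, b, e) \<in> T" using a b e fin(3)[OF A] by (auto simp: T_def)
      have "cl a b \<union> cl a e \<subseteq> A" using cl3 a b e ae by auto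
      then have "A \<in> {A \<in> [V]\<^bsup>k\<^esup>. cl a b \<union> cl a e \<subseteq> A}" using A assms(2) by blast
      with \<open>(a, b, e) \<in> T\<close> have "A \<in> H" unfolding H_def by blast
      then show ?thesis by simp
    qed
  qed
  moreover have finLH: "finite L" "finite H"
  proof -
    show "finite L" by (rule finite_subset[OF _ finE]) (auto simp: L_def P_def)
    show "finite H" by (rule finite_subset[OF _ finite_imp_finite_nsets[OF assms(1), of k]]) (auto simp: H_def)
  qed
  ultimately have "card E \<le> card L + card H"
    using card_mono[of "L \<union> H" E] card_Un_le[of L H] by simp
  then have "card E * ?n ^ 2 \<le> card L * ?n ^ 2 + card H * ?n ^ 2" by (simp flip: add_mult_distrib)
  \<comment> \<open>There are at most n^2 light pairs with at most k^2 n^(k-4) sets each.\<close>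
  also have "card L * ?n ^ 2 \<le> k\<^sup>2 * ?n ^ k"
  proof (cases "?n = 0")
    case False
    have "card L * ?n ^ 4 \<le> card {(a, b) \<in> V \<times> V. light a b} * (k\<^sup>2 * ?n ^ k)"
      unfolding L_def
    proof (rule card_UN_mult_le)
      show "finite {(a, b) \<in> V \<times> V. light a b}" using assms(1) by (auto intro: finite_subset[of _ "V \<times> V"])
    qed (auto simp: light_def)
    also have "card {(a, b) \<in> V \<times> V. light a b} \<le> card (V \<times> V)"
      using assms(1) by (intro card_mono) auto
    finally have "?n ^ 2 * (card L * ?n ^ 2) \<le> ?n ^ 2 * (k\<^sup>2 * ?n ^ k)"
      by (simp add: card_cartesian_product power2_eq_square power4_eq_xxxx mult_ac)
    then show ?thesis using False by simp
  qed simp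
  \<comment> \<open>At most n^3 choices of (a, b, e), each fixing five points of the set; for k = 4
    the family \<open>H\<close> is empty.\<close>
  also have "card H * ?n ^ 2 \<le> ?n ^ k"
  proof (cases "?n = 0")
    case False
    have finT: "finite T" using assms(1) by (auto simp: T_def intro: finite_subset[of _ "V \<times> V \<times> V"])
    have "card H * ?n ^ 5 \<le> card T * ?n ^ k"
      unfolding H_def
    proof (rule card_UN_mult_le[OF finT], clarify)
      fix a b e assume "(a, b, e) \<in> T"
      then have "card (cl a b \<union> cl a e) = 5" by (simp add: T_def)
      then show "card {A \<in> [V]\<^bsup>k\<^esup>. cl a b \<union> cl a e \<subseteq> A} * ?n ^ 5 \<le> ?n ^ k"
        using card_nsets_supset_le[OF assms(1), of k "cl a b \<union> cl a e"] by simp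
    qed
    also have "card T \<le> card (V \<times> V \<times> V)"
      using assms(1) by (intro card_mono) (auto simp: T_def)
    also have "\<dots> = ?n ^ 3" by (simp add: card_cartesian_product power3_eq_cube)
    finally have "?n ^ 3 * (card H * ?n ^ 2) \<le> ?n ^ 3 * ?n ^ k"
      by (simp add: mult_ac flip: power_add)
    then show ?thesis using False by simp
  qed simp
  finally show ?thesis by simp
qed

section \<open>The centre of a large 4-cluster-free family\<close>

definition own :: "'a set set \<Rightarrow> 'a set \<Rightarrow> 'a set" where
  "own F A = {v \<in> A. \<forall>C\<in>F. A - {v} \<subseteq> C \<longrightarrow> C = A}"

locale cluster_free_family =
  fixes V :: "'a set" and k :: nat and F :: "'a set set"
  assumes finV: "finite V" and k4: "k \<ge> 4" and F_sub: "F \<subseteq> [V]\<^bsup>k\<^esup>"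
    and cf: "d_cluster_free 4 k F"
begin

abbreviation n where "n \<equiv> card V"

lemma finF: "finite F"
  using F_sub finV by (meson finite_subset finite_imp_finite_nsets)

lemma memF: "finite A" "card A = k" "A \<subseteq> V" if "A \<in> F"
  using that F_sub by (auto simp: nsets_def)

definition F0 where "F0 = {A \<in> F. own F A = {}}"
definition F1 where "F1 = {A \<in> F. card (own F A) = 1}"
text \<open>On \<open>F1\<close> the set \<open>own F A\<close> is a singleton, so the set
  difference drops exactly one vertex and no choice function is involved.\<close>

definition uncovered where "uncovered = [V]\<^bsup>(k - 1)\<^esup> - (\<lambda>A. A - own F A) ` F1"

lemma own_sub: "own F A \<subseteq> A"
  by (auto simp: own_def)

lemma own_unique: "v \<in> own F A \<Longrightarrow> C \<in> F \<Longrightarrow> A - {v} \<subseteq> C \<Longrightarrow> C = A"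
  by (auto simp: own_def)

lemma sum_card_own: "(\<Sum>A\<in>F. card (own F A)) \<le> n choose (k - 1)"
proof -
  have fin: "finite (own F A)" if "A \<in> F" for A
    using that own_sub memF finite_subset by blast
  have "card (Sigma F (own F)) \<le> card ([V]\<^bsup>(k - 1)\<^esup>)"
  proof (rule card_inj_on_le[where f = "\<lambda>(A, v). A - {v}"])
    show "inj_on (\<lambda>(A, v). A - {v}) (Sigma F (own F))"
    proof (rule inj_onI, clarify)
      fix A v A' v' assume h: "A \<in> F" "v \<in> own F A" "A' \<in> F" "v' \<in> own F A'" "A - {v} = A' - {v'}"
      then have "A' = A" using own_unique[of v A A'] by blast
      then show "A = A' \<and> v = v'" using h own_sub by blast
    qed
    show "(\<lambda>(A, v). A - {v}) ` Sigma F (own F) \<subseteq> [V]\<^bsup>(k - 1)\<^esup>"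
      using memF own_sub by (fastforce simp: nsets_def)
  qed (use finV in \<open>simp add: finite_imp_finite_nsets\<close>)
  then show ?thesis using finF fin by simp
qed

lemma F0_F1_sub: "F0 \<subseteq> F" "F1 \<subseteq> F" "finite F0" "finite F1"
  using finF by (auto simp: F0_def F1_def)

text \<open>Members have at least two own vertices each, except that those of \<open>F1\<close> fall
  short by one and those of \<open>F0\<close> by two. Comparison with \<open>sum_card_own\<close>
  gives both bounds.\<close>

lemma own_counts:
  "2 * card F \<le> (n choose (k - 1)) + 2 * card F0 + card F1"
  "card F \<le> (n choose (k - 1)) + card F0"
proof -
  have [simp]: "(\<Sum>A\<in>F. of_bool (A \<in> X)) = card X" if "X \<subseteq> F" for X
    using that finF by (simp add: of_bool_def sum.If_cases Int_absorb1)
  have pos: "card (own F A) > 0" if "A \<in> F" "A \<notin> F0" for A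
    using that memF own_sub by (metis (lifting) F0_def card_gt_0_iff finite_subset mem_Collect_eq)
  have "(\<Sum>A\<in>F. 2) \<le> (\<Sum>A\<in>F. card (own F A) + 2 * of_bool (A \<in> F0) + of_bool (A \<in> F1))"
    using pos by (intro sum_mono) (force simp: F1_def)
  also have "\<dots> = (\<Sum>A\<in>F. card (own F A)) + 2 * card F0 + card F1"
    using F0_F1_sub by (simp add: sum.distrib flip: sum_distrib_left)
  finally show "2 * card F \<le> (n choose (k - 1)) + 2 * card F0 + card F1"
    using sum_card_own by simp
  have "(\<Sum>A\<in>F. 1) \<le> (\<Sum>A\<in>F. card (own F A) + of_bool (A \<in> F0))"
    using pos by (intro sum_mono) force
  also have "\<dots> = (\<Sum>A\<in>F. card (own F A)) + card F0"
    using F0_F1_sub by (simp add: sum.distrib)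
  finally show "card F \<le> (n choose (k - 1)) + card F0"
    using sum_card_own by simp
qed

lemma F1_E:
  assumes "A \<in> F1" obtains x where "own F A = {x}" "x \<in> A" "A - own F A \<in> [V]\<^bsup>(k - 1)\<^esup>"
proof -
  obtain x where x: "own F A = {x}" using assms by (auto simp: F1_def card_1_singleton_iff)
  then have "x \<in> A" using own_sub by blast
  then show thesis using that x memF[of A] assms F0_F1_sub by (auto simp: nsets_def)
qed

lemma inj_on_F1: "inj_on (\<lambda>A. A - own F A) F1"
proof (rule inj_onI)
  fix A A' assume h: "A \<in> F1" "A' \<in> F1" "A - own F A = A' - own F A'"
  obtain x where "own F A = {x}" using F1_E[OF h(1)] by blast
  then show "A = A'" using own_unique[of x A A'] h F0_F1_sub by blast
qed

lemma card_uncovered: "card uncovered + card F1 = n choose (k - 1)"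
proof -
  have sub: "(\<lambda>A. A - own F A) ` F1 \<subseteq> [V]\<^bsup>(k - 1)\<^esup>"
    by (auto elim: F1_E)
  have fin: "finite ([V]\<^bsup>(k - 1)\<^esup>)" using finV by (simp add: finite_imp_finite_nsets)
  have "card uncovered = (n choose (k - 1)) - card F1"
    using sub fin F0_F1_sub by (simp add: uncovered_def card_Diff_subset card_image[OF inj_on_F1])
  moreover have "card F1 \<le> n choose (k - 1)"
    using card_mono[OF fin sub] by (simp add: card_image[OF inj_on_F1])
  ultimately show ?thesis by simp
qed

lemma not_own_intersection:
  assumes "A \<in> F" "A' \<in> F" "d \<in> A - own F A" "a \<in> A - own F A" "d \<noteq> a" "d \<in> A'" "a \<in> A'"
  shows "card (A \<inter> A') \<noteq> 2"
proof
  assume "card (A \<inter> A') = 2"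
  moreover have "{d, a} \<subseteq> A \<inter> A'" "card {d, a} = 2" using assms by auto
  ultimately have eq: "A \<inter> A' = {d, a}" using assms memF
    by (metis card_subset_eq finite_Int)
  obtain C C' where "C \<in> F" "A - {d} \<subseteq> C" "C \<noteq> A" "C' \<in> F" "A - {a} \<subseteq> C'" "C' \<noteq> A"
    using assms by (auto simp: own_def)
  then show False
    using cluster_if_intersection_two[OF cf F_sub k4 assms(1,2) eq assms(5)] by blast
qed

lemma card_F0: "n ^ 2 * card F0 \<le> (k\<^sup>2 + 1) * n ^ k"
proof -
  have "card (A \<inter> A') \<noteq> 2" if "A \<in> F0" "A' \<in> F0" for A A'
  proof
    assume c: "card (A \<inter> A') = 2"
    then obtain d a where "A \<inter> A' = {d, a}" "d \<noteq> a" by (auto simp: card_2_iff)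
    then have "d \<in> A - own F A" "a \<in> A - own F A" "d \<in> A'" "a \<in> A'" "A \<in> F" "A' \<in> F"
      using that by (auto simp: F0_def)
    then show False using c not_own_intersection \<open>d \<noteq> a\<close> by blast
  qed
  moreover have "F0 \<subseteq> [V]\<^bsup>k\<^esup>" using F_sub F0_F1_sub by blast
  ultimately show ?thesis using no_intersection_two_bound[OF finV _ k4, of F0] by (simp add: mult.commute)
qed

text \<open>\<open>card_uncovered\<close> turns the first bound of \<open>own_counts\<close> into
  |uncovered| <= 2 (binom(n,k-1) - |F|) + 2 |F0|: the deficit of F is at most doubled, and
  \<open>card_F0\<close> bounds the rest.\<close>

lemma card_uncovered_le:
  assumes "n ^ 2 * (n choose (k - 1)) \<le> n ^ 2 * card F + c * n ^ k"
  shows "n ^ 2 * card uncovered \<le> (2 * c + 2 * (k\<^sup>2 + 1)) * n ^ k"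
proof -
  have "card uncovered + 2 * card F \<le> 2 * (n choose (k - 1)) + 2 * card F0"
    using card_uncovered own_counts(1) by linarith
  then have "n ^ 2 * (card uncovered + 2 * card F) \<le> n ^ 2 * (2 * (n choose (k - 1)) + 2 * card F0)"
    by (rule mult_le_mono2)
  then have "n ^ 2 * card uncovered + 2 * (n ^ 2 * card F) \<le>
    2 * (n ^ 2 * (n choose (k - 1))) + 2 * (n ^ 2 * card F0)"
    by (simp add: algebra_simps)
  then have "n ^ 2 * card uncovered \<le> 2 * (c * n ^ k) + 2 * ((k\<^sup>2 + 1) * n ^ k)"
    using assms card_F0 by linarith
  then show ?thesis by (simp add: algebra_simps)
qed

section \<open>A pair with few exceptions and its third vertex\<close>

text \<open>Averaging over ordered pairs. An uncovered set contains at most k^2 pairs, and a member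
  of \<open>F1\<close> has one own vertex, hence counts for at most n pairs in either coordinate.
  With weight n^2 on the uncovered sets all three totals are O(n^k), so a single pair is good for
  all three quantities at once. The factor 2 comes from n^2 <= 2 n (n-1).\<close>

lemma good_pair:
  assumes U: "n ^ 2 * card uncovered \<le> c * n ^ k" and n2: "n \<ge> 2"
  obtains d a where "d \<in> V" "a \<in> V" "d \<noteq> a"
    "n ^ 2 * (n ^ 2 * card {g \<in> uncovered. d \<in> g \<and> a \<in> g} + card {A \<in> F1. d \<in> own F A}
       + card {A \<in> F1. a \<in> own F A}) \<le> 2 * (k\<^sup>2 * c + 2) * n ^ k"
proof -
  define P where "P = {(d, a) \<in> V \<times> V. d \<noteq> a}"
  define u where "u p = card {g \<in> uncovered. fst p \<in> g \<and> snd p \<in> g}" for p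
  define w where "w d = card {A \<in> F1. d \<in> own F A}" for d
  have finP: "finite P" using finV by (auto simp: P_def intro: finite_subset[of _ "V \<times> V"])
  have finU: "finite uncovered" using finV by (simp add: uncovered_def finite_imp_finite_nsets)
  have P_eq: "P = (SIGMA d:V. V - {d})" by (auto simp: P_def)
  have cardP: "card P = n * (n - 1)" unfolding P_eq using finV by simp
  have "(\<Sum>p\<in>P. u p) = (\<Sum>g\<in>uncovered. card {p \<in> P. fst p \<in> g \<and> snd p \<in> g})"
    unfolding u_def by (rule sum_multicount_gen) (use finP finU in auto)
  also have "\<dots> \<le> (\<Sum>g\<in>uncovered. k\<^sup>2)"
  proof (rule sum_mono)
    fix g assume "g \<in> uncovered"
    then have g: "finite g" "card g = k - 1" by (auto simp: uncovered_def nsets_def)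
    have "card {p \<in> P. fst p \<in> g \<and> snd p \<in> g} \<le> card (g \<times> g)"
      using g by (intro card_mono) auto
    also have "\<dots> \<le> k\<^sup>2" using g by (simp add: card_cartesian_product power2_eq_square mult_le_mono)
    finally show "card {p \<in> P. fst p \<in> g \<and> snd p \<in> g} \<le> k\<^sup>2" .
  qed
  finally have u: "(\<Sum>p\<in>P. u p) \<le> k\<^sup>2 * card uncovered" by (simp add: mult.commute)
  have "(\<Sum>d\<in>V. w d) = (\<Sum>A\<in>F1. 1)"
    unfolding w_def
  proof (rule sum_multicount_gen)
    show "\<forall>A\<in>F1. card {d \<in> V. d \<in> own F A} = 1"
    proof
      fix A assume A: "A \<in> F1"
      then have "{d \<in> V. d \<in> own F A} = own F A" using own_sub memF F0_F1_sub by blast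
      then show "card {d \<in> V. d \<in> own F A} = 1" using A by (simp add: F1_def)
    qed
  qed (use finV F0_F1_sub in auto)
  also have "\<dots> \<le> n ^ (k - 1)"
    using card_uncovered binomial_le_power[of n "k - 1"] by simp
  finally have "n * (\<Sum>d\<in>V. w d) \<le> n * n ^ (k - 1)" by simp
  then have w: "n * (\<Sum>d\<in>V. w d) \<le> n ^ k" using k4 by (simp flip: power_Suc)
  have "(\<Sum>p\<in>P. w (fst p)) = (n - 1) * (\<Sum>d\<in>V. w d)"
    unfolding P_eq using finV by (subst sum.Sigma[symmetric, where g = "\<lambda>d a. w d" for w, simplified case_prod_unfold]) (auto simp: sum_distrib_left)
  moreover have "(\<Sum>p\<in>P. w (snd p)) = (\<Sum>p\<in>P. w (fst p))"
    by (rule sum.reindex_bij_witness[of _ prod.swap prod.swap]) (auto simp: P_def)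
  moreover have "(n - 1) * (\<Sum>d\<in>V. w d) \<le> n * (\<Sum>d\<in>V. w d)" by simp
  ultimately have w2: "(\<Sum>p\<in>P. w (fst p)) \<le> n ^ k" "(\<Sum>p\<in>P. w (snd p)) \<le> n ^ k"
    using w by linarith+
  define z where "z p = n ^ 2 * u p + w (fst p) + w (snd p)" for p
  have "(\<Sum>p\<in>P. z p) \<le> (k\<^sup>2 * c + 2) * n ^ k"
  proof -
    have "(\<Sum>p\<in>P. z p) = n ^ 2 * (\<Sum>p\<in>P. u p) + (\<Sum>p\<in>P. w (fst p)) + (\<Sum>p\<in>P. w (snd p))"
      by (simp add: z_def sum.distrib sum_distrib_left)
    also have "n ^ 2 * (\<Sum>p\<in>P. u p) \<le> n ^ 2 * (k\<^sup>2 * card uncovered)" using u by simp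
    also have "\<dots> = k\<^sup>2 * (n ^ 2 * card uncovered)" by simp
    also have "\<dots> \<le> k\<^sup>2 * (c * n ^ k)" using U by (rule mult_le_mono2)
    finally show ?thesis using w2 by (simp add: algebra_simps)
  qed
  moreover have "\<exists>p\<in>P. card P * z p \<le> (\<Sum>p\<in>P. z p)"
  proof (rule ccontr)
    assume c: "\<not> ?thesis"
    have "n * (n - 1) > 0" using n2 by simp
    then have "P \<noteq> {}" using cardP by (metis card.empty less_irrefl)
    then have "(\<Sum>q\<in>P. \<Sum>p\<in>P. z p) < (\<Sum>q\<in>P. card P * z q)"
      using c finP by (intro sum_strict_mono) auto
    then show False by (simp flip: sum_distrib_left)
  qed
  ultimately obtain p where p: "p \<in> P" "card P * z p \<le> (k\<^sup>2 * c + 2) * n ^ k" by force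
  have "n ^ 2 \<le> 2 * card P" using n2 by (cases n) (auto simp: cardP power2_eq_square)
  then have "n ^ 2 * z p \<le> 2 * card P * z p" by (rule mult_le_mono1)
  also have "\<dots> \<le> 2 * (k\<^sup>2 * c + 2) * n ^ k" using p by simp
  finally show thesis using p(1) that[of "fst p" "snd p"]
    by (auto simp: z_def u_def w_def P_def)
qed

text \<open>Outside \<open>F1\<close> there are at most |uncovered| + |F0| members. Those of
  \<open>F1\<close> with d as a non-own vertex correspond injectively to (k-1)-sets through d, of
  which there are at most n^(k-2). The remaining ones have d as own vertex and stay in the bound as
  a separate term.\<close>

lemma degree_le:
  assumes "d \<in> V"
  shows "n ^ 2 * card {B \<in> F. d \<in> B} \<le>
    n ^ 2 * card uncovered + n ^ 2 * card F0 + n ^ k + n ^ 2 * card {A \<in> F1. d \<in> own F A}"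
proof -
  let ?X = "{A \<in> F1. d \<in> A - own F A}"
  have "n * card ?X \<le> n ^ (k - 1)"
  proof -
    have "card ?X \<le> card {g \<in> [V]\<^bsup>(k - 1)\<^esup>. {d} \<subseteq> g}"
    proof (rule card_inj_on_le[where f = "\<lambda>A. A - own F A"])
      show "inj_on (\<lambda>A. A - own F A) ?X" using inj_on_F1 by (rule inj_on_subset) auto
      show "(\<lambda>A. A - own F A) ` ?X \<subseteq> {g \<in> [V]\<^bsup>(k - 1)\<^esup>. {d} \<subseteq> g}" using F1_E by blast
    qed (use finV in \<open>simp add: finite_imp_finite_nsets\<close>)
    then have "n * card ?X \<le> n * card {g \<in> [V]\<^bsup>(k - 1)\<^esup>. {d} \<subseteq> g}" by (rule mult_le_mono2)
    also have "\<dots> \<le> n ^ (k - 1)"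
      using card_nsets_supset_le[OF finV, of "k - 1" "{d}"] by (simp add: mult.commute)
    finally show ?thesis .
  qed
  then have X: "n ^ 2 * card ?X \<le> n ^ k"
    using mult_le_mono2[of "n * card ?X" "n ^ (k - 1)" n] k4
    by (simp add: power2_eq_square mult.assoc flip: power_Suc)
  have "{B \<in> F. d \<in> B} \<subseteq> (F - F1) \<union> ?X \<union> {A \<in> F1. d \<in> own F A}" by auto
  then have "card {B \<in> F. d \<in> B} \<le> card ((F - F1) \<union> ?X \<union> {A \<in> F1. d \<in> own F A})"
    using finF F0_F1_sub by (intro card_mono) auto
  also have "\<dots> \<le> card (F - F1) + card ?X + card {A \<in> F1. d \<in> own F A}"
    by (meson add_le_mono card_Un_le le_refl order_trans)
  also have "card (F - F1) = card F - card F1" using F0_F1_sub by (simp add: card_Diff_subset)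
  also have "\<dots> \<le> card uncovered + card F0" using card_uncovered own_counts(2) by linarith
  finally have "n ^ 2 * card {B \<in> F. d \<in> B} \<le>
      n ^ 2 * (card uncovered + card F0 + card ?X + card {A \<in> F1. d \<in> own F A})" by simp
  then show ?thesis using X by (simp add: algebra_simps)
qed

text \<open>Almost every (k-1)-set g through d, a arises from a member in \<open>E\<close>, so
  \<open>E\<close> has order n^(k-3). This exceeds the k^2 n^(k-4) allowed by
  \<open>common_vertex_or_few\<close>, and a common x exists. If g misses x and comes from A in
  \<open>E\<close>, then the vertex dropped from A must be x, so g + x is a member. Hence every
  missing set at {x, d, a} yields an uncovered g.\<close>

lemma common_third_vertex:
  assumes da: "d \<in> V" "a \<in> V" "d \<noteq> a" and k: "k \<le> n"
    and u: "n ^ 4 * card {g \<in> uncovered. d \<in> g \<and> a \<in> g} \<le> c * n ^ k"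
    and large: "n > (2 * k) ^ (k - 3) * (c + k\<^sup>2)"
  obtains x where "x \<in> V" "x \<noteq> d" "x \<noteq> a"
    "card {h \<in> [V - {x, d, a}]\<^bsup>(k - 3)\<^esup>. {x, d, a} \<union> h \<notin> F} \<le> card {g \<in> uncovered. d \<in> g \<and> a \<in> g}"
proof -
  define E where "E = {A \<in> F1. d \<in> A - own F A \<and> a \<in> A - own F A}"
  let ?U = "{g \<in> uncovered. d \<in> g \<and> a \<in> g}"
  have E_sub: "E \<subseteq> F" using F0_F1_sub by (auto simp: E_def)
  have finE: "finite E" using E_sub finF finite_subset by blast
  have finU: "finite ?U" using finV by (simp add: uncovered_def finite_imp_finite_nsets)
  have ins: "insert d (insert a h) \<in> [V]\<^bsup>(k - 1)\<^esup>" "insert d (insert a h) - {d, a} = h"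
    if "h \<in> [V - {d, a}]\<^bsup>(k - 3)\<^esup>" for h
  proof -
    have h: "h \<subseteq> V" "finite h" "card h = k - 3" "d \<notin> h" "a \<notin> h" using that by (auto simp: nsets_def)
    then show "insert d (insert a h) \<in> [V]\<^bsup>(k - 1)\<^esup>" using da k4 by (auto simp: nsets_def)
    show "insert d (insert a h) - {d, a} = h" using h by auto
  qed
  have "(n - 2) choose (k - 3) = card ([V - {d, a}]\<^bsup>(k - 3)\<^esup>)"
    using da finV by (simp add: card_Diff_subset numeral_2_eq_2)
  also have "\<dots> \<le> card ((\<lambda>g. g - {d, a}) ` ?U \<union> (\<lambda>A. A - own F A - {d, a}) ` E)"
  proof (rule card_mono)
    show "[V - {d, a}]\<^bsup>(k - 3)\<^esup> \<subseteq> (\<lambda>g. g - {d, a}) ` ?U \<union> (\<lambda>A. A - own F A - {d, a}) ` E"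
    proof
      fix h assume h: "h \<in> [V - {d, a}]\<^bsup>(k - 3)\<^esup>"
      let ?g = "insert d (insert a h)"
      show "h \<in> (\<lambda>g. g - {d, a}) ` ?U \<union> (\<lambda>A. A - own F A - {d, a}) ` E"
      proof (cases "?g \<in> uncovered")
        case True
        then have "?g \<in> ?U" by simp
        then have "?g - {d, a} \<in> (\<lambda>g. g - {d, a}) ` ?U" by (rule imageI)
        then show ?thesis using ins(2)[OF h] by simp
      next
        case False
        then obtain A where A: "A \<in> F1" "?g = A - own F A" using ins(1)[OF h] by (auto simp: uncovered_def)
        then have "A \<in> E" by (auto simp: E_def)
        then have "A - own F A - {d, a} \<in> (\<lambda>A. A - own F A - {d, a}) ` E" by (rule imageI)
        then show ?thesis using ins(2)[OF h] A(2) by simp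
      qed
    qed
  qed (use finE finU in simp)
  also have "\<dots> \<le> card ?U + card E"
    by (rule order_trans[OF card_Un_le add_mono[OF card_image_le[OF finU] card_image_le[OF finE]]])
  finally have count: "(n - 2) choose (k - 3) \<le> card ?U + card E" .
  have many: "\<not> card E * n ^ 4 \<le> k\<^sup>2 * n ^ k"
  proof
    assume "card E * n ^ 4 \<le> k\<^sup>2 * n ^ k"
    then have "n ^ 4 * (card ?U + card E) \<le> (c + k\<^sup>2) * n ^ k" using u by (simp add: algebra_simps)
    then have le: "n ^ 4 * ((n - 2) choose (k - 3)) \<le> (c + k\<^sup>2) * n ^ k"
      using count by (meson le_trans mult_le_mono2)
    have "n ^ (k - 3) \<le> (2 * k) ^ (k - 3) * ((n - 2) choose (k - 3))"
      using k k4 by (intro power_le_binomial) auto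
    then have "n ^ 4 * n ^ (k - 3) \<le> n ^ 4 * ((2 * k) ^ (k - 3) * ((n - 2) choose (k - 3)))" by simp
    also have "\<dots> \<le> (2 * k) ^ (k - 3) * ((c + k\<^sup>2) * n ^ k)" using le by (simp add: mult.left_commute)
    finally have "n ^ 4 * n ^ (k - 3) \<le> (2 * k) ^ (k - 3) * (c + k\<^sup>2) * n ^ k" by (simp add: mult.assoc)
    moreover have "n ^ 4 * n ^ (k - 3) = n * n ^ k" using k4 by (simp flip: power_add power_Suc)
    ultimately have "n \<le> (2 * k) ^ (k - 3) * (c + k\<^sup>2)" using k k4 by simp
    then show False using large by simp
  qed
  then have "E \<noteq> {}" by auto
  have "card (A \<inter> A') \<noteq> 2" if "A \<in> E" "A' \<in> E" for A A'
    using that E_sub da by (intro not_own_intersection[of A A' d a]) (auto simp: E_def)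
  then have "(\<exists>x. x \<noteq> d \<and> x \<noteq> a \<and> (\<forall>A\<in>E. x \<in> A)) \<or> card E * n ^ 4 \<le> k\<^sup>2 * n ^ k"
    using E_sub F_sub da by (intro common_vertex_or_few[OF finV]) (auto simp: E_def)
  then obtain x where x: "x \<noteq> d" "x \<noteq> a" "\<forall>A\<in>E. x \<in> A" using many by blast
  then have "x \<in> V" using \<open>E \<noteq> {}\<close> E_sub memF by blast
  moreover have "card {h \<in> [V - {x, d, a}]\<^bsup>(k - 3)\<^esup>. {x, d, a} \<union> h \<notin> F} \<le> card ?U"
  proof (rule card_inj_on_le[where f = "\<lambda>h. insert d (insert a h)"])
    show "inj_on (\<lambda>h. insert d (insert a h)) {h \<in> [V - {x, d, a}]\<^bsup>(k - 3)\<^esup>. {x, d, a} \<union> h \<notin> F}"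
      unfolding inj_on_def nsets_def by blast
    show "(\<lambda>h. insert d (insert a h)) ` {h \<in> [V - {x, d, a}]\<^bsup>(k - 3)\<^esup>. {x, d, a} \<union> h \<notin> F} \<subseteq> ?U"
    proof clarify
      fix h assume h: "h \<in> [V - {x, d, a}]\<^bsup>(k - 3)\<^esup>" "{x, d, a} \<union> h \<notin> F"
      let ?g = "insert d (insert a h)"
      have h': "h \<in> [V - {d, a}]\<^bsup>(k - 3)\<^esup>" "x \<notin> ?g" using h(1) x by (auto simp: nsets_def)
      have "?g \<in> uncovered"
      proof (rule ccontr)
        assume "?g \<notin> uncovered"
        then obtain A where A: "A \<in> F1" "?g = A - own F A" using ins(1)[OF h'(1)] by (auto simp: uncovered_def)
        then have "A \<in> E" by (auto simp: E_def)
        then have "x \<in> A" using x by blast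
        obtain y where y: "own F A = {y}" using F1_E[OF A(1)] by blast
        have "x \<notin> A - {y}" using h'(2) A(2) y by simp
        then have "y = x" using \<open>x \<in> A\<close> by simp
        then have "A = insert x ?g" using insert_Diff[OF \<open>x \<in> A\<close>] A(2) y by simp
        then have "A = {x, d, a} \<union> h" by simp
        moreover have "A \<in> F" using A(1) F0_F1_sub by blast
        ultimately show False using h(2) by simp
      qed
      then show "?g \<in> uncovered \<and> d \<in> ?g \<and> a \<in> ?g" by simp
    qed
  qed (rule finU)
  ultimately show thesis using that x by blast
qed

text \<open>For $h$ with $D \cup h \in F$ and $y \in h$, the sets $B$, $D \cup h$, $D \cup (h - y) \cup \{b\}$ and
  $D \cup (h - y) \cup \{b'\}$ would form a cluster.  So of any two points of $B$ at least one lies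
  in the bounded set \<open>S\<close> of points in many missing sets.\<close>

lemma blocking:
  fixes c :: nat
  defines "s \<equiv> 4 * (2 * k) ^ k * k * c"
  assumes D: "D \<subseteq> V" "card D < k"
    and W: "n ^ (card D + 1) * card {h \<in> [V - D]\<^bsup>(k - card D)\<^esup>. D \<union> h \<notin> F} \<le> c * n ^ k"
    and large: "n \<ge> 4 * k" "n \<ge> 2 * (2 * k) ^ k * c"
  shows "card {B \<in> F. B \<inter> D = {}} \<le> 2 ^ s * (n + 1)"
proof -
  define q where "q = card D"
  define W where "W = {h \<in> [V - D]\<^bsup>(k - q)\<^esup>. D \<union> h \<notin> F}"
  define Wb where "Wb b = {h \<in> W. b \<in> h}" for b
  \<comment> \<open>S collects the points lying in a fixed positive fraction of the n^(k-q-1) sets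
    that they could lie in. The factor 4 splits as 2 * 2: one half of the total is lost to
    \<open>W\<close>, the rest is shared by b and b'.\<close>
  define S where "S = {b \<in> V. n ^ k \<le> 4 * (2 * k) ^ k * (n ^ (q + 1) * card (Wb b))}"
  have finD: "finite D" using D finV finite_subset by blast
  have qk: "q < k" using D by (simp add: q_def)
  have finW: "finite W" using finV by (simp add: W_def finite_imp_finite_nsets)
  have W': "n ^ (q + 1) * card W \<le> c * n ^ k" using W by (simp add: W_def q_def)
  have n0: "n > 0" using large k4 by simp
  have popular: "b \<in> S \<or> b' \<in> S"
    if B: "B \<in> F" "B \<inter> D = {}" "b \<in> B" "b' \<in> B" "b \<noteq> b'" for B b b'
  proof -
    note mB = memF[OF B(1)]
    let ?P = "[V - D - B]\<^bsup>(k - q)\<^esup>"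
    \<comment> \<open>\<open>f\<close> recovers h from the missing set obtained by exchanging y for
      b. As y is free, each missing set accounts for at most n sets h.\<close>
    define f :: "'a \<times> 'a \<times> 'a set \<Rightarrow> 'a set" where "f = (\<lambda>(y, b, w). insert y (w - {b}))"
    have "?P \<subseteq> W \<union> f ` (V \<times> {b} \<times> Wb b) \<union> f ` (V \<times> {b'} \<times> Wb b')"
    proof
      fix h assume h: "h \<in> ?P"
      then have hs: "finite h" "card h = k - q" "h \<subseteq> V" "h \<inter> D = {}" "h \<inter> B = {}"
        by (auto simp: nsets_def)
      show "h \<in> W \<union> f ` (V \<times> {b} \<times> Wb b) \<union> f ` (V \<times> {b'} \<times> Wb b')"
      proof (cases "D \<union> h \<in> F")
        case False
        then show ?thesis using h by (auto simp: W_def nsets_def)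
      next
        case True
        have "h \<noteq> {}" using hs qk by auto
        then obtain y where y: "y \<in> h" by blast
        define e where "e = h - {y}"
        have e: "finite e" "card e = k - q - 1" "e \<inter> D = {}" "e \<inter> B = {}" "e \<subseteq> V" "y \<notin> e" "h = insert y e"
          using hs y by (auto simp: e_def)
        have refill: "h = f (y, v, insert v e)" "insert v e \<in> [V - D]\<^bsup>(k - q)\<^esup>" if "v \<in> B" for v
        proof -
          have "v \<notin> e" "v \<in> V" "v \<notin> D" using that e B mB by auto
          then show "h = f (y, v, insert v e)" "insert v e \<in> [V - D]\<^bsup>(k - q)\<^esup>"
            using e qk by (auto simp: f_def nsets_def)
        qed
        have "D \<union> insert b e \<notin> F \<or> D \<union> insert b' e \<notin> F"
        proof (rule ccontr)
          assume "\<not> ?thesis"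
          then have in_F: "D \<union> insert b e \<in> F" "D \<union> insert b' e \<in> F" by auto
          have "b \<notin> D \<union> h" "b' \<notin> D \<union> h" "b \<notin> D \<union> insert b' e" using B hs e by auto
          moreover have "y \<notin> D" "y \<notin> B" using hs y by auto
          moreover have "b \<noteq> y" "b' \<noteq> y" using B y hs by auto
          ultimately have dist: "distinct [B, D \<union> h, D \<union> insert b e, D \<union> insert b' e]"
            using B e by auto
          have int: "B \<inter> (D \<union> h) \<inter> (D \<union> insert b e) \<inter> (D \<union> insert b' e) = {}" using B hs by auto
          \<comment> \<open>The exchanged points b, b' belong to B, so all four sets fit into B and
            D + h, which have k points each.\<close>
          have "B \<union> (D \<union> h) \<union> (D \<union> insert b e) \<union> (D \<union> insert b' e) = B \<union> (D \<union> h)"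
            using B e by auto
          moreover have "card (B \<union> (D \<union> h)) \<le> card B + (card D + card h)"
            by (meson add_left_mono card_Un_le order_trans)
          ultimately have "card (B \<union> (D \<union> h) \<union> (D \<union> insert b e) \<union> (D \<union> insert b' e)) \<le> 2 * k"
            using mB hs qk by (simp add: q_def)
          then show False using four_sets_cluster_freeD[OF cf B(1) True in_F F_sub dist int] by simp
        qed
        then have "insert b e \<in> Wb b \<or> insert b' e \<in> Wb b'"
          using refill[OF B(3)] refill[OF B(4)] by (auto simp: Wb_def W_def)
        then show ?thesis using refill[OF B(3)] refill[OF B(4)] y hs by blast
      qed
    qed
    have img: "card (f ` (V \<times> {v} \<times> Wb v)) \<le> card (V \<times> {v} \<times> Wb v)" for v
      by (rule card_image_le) (use finV finW in \<open>simp add: Wb_def\<close>)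
    from \<open>?P \<subseteq> _\<close> have "card ?P \<le> card (W \<union> f ` (V \<times> {b} \<times> Wb b) \<union> f ` (V \<times> {b'} \<times> Wb b'))"
      by (rule card_mono[rotated]) (use finW finV in \<open>auto simp: Wb_def\<close>)
    also have "\<dots> \<le> card W + card (V \<times> {b} \<times> Wb b) + card (V \<times> {b'} \<times> Wb b')"
      by (rule order_trans[OF card_Un_le add_mono[OF order_trans[OF card_Un_le add_mono[OF order_refl img]] img]])
    finally have P: "card ?P \<le> card W + n * (card (Wb b) + card (Wb b'))"
      by (simp add: card_cartesian_product algebra_simps)
    have "card (D \<union> B) = q + k" using B mB finD by (subst card_Un_disjoint) (auto simp: q_def)
    moreover have "V - D - B = V - (D \<union> B)" by blast
    moreover have "D \<union> B \<subseteq> V" using D mB by blast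
    ultimately have cP: "card ?P = (n - (q + k)) choose (k - q)"
      using mB finD by (simp add: card_Diff_subset)
    have "n ^ (k - q) \<le> (2 * k) ^ (k - q) * card ?P"
      unfolding cP using large qk by (intro power_le_binomial) auto
    also have "\<dots> \<le> (2 * k) ^ k * card ?P"
      using k4 by (intro mult_le_mono1 power_increasing) auto
    also have "\<dots> \<le> (2 * k) ^ k * (card W + n * (card (Wb b) + card (Wb b')))"
      using P by simp
    finally have "n ^ (q + 1) * n ^ (k - q) \<le>
        n ^ (q + 1) * ((2 * k) ^ k * (card W + n * (card (Wb b) + card (Wb b'))))" by (rule mult_le_mono2)
    also have "n ^ (q + 1) * n ^ (k - q) = n * n ^ k" using qk by (simp flip: power_add power_Suc)
    finally have main: "n * n ^ k \<le> (2 * k) ^ k * (n ^ (q + 1) * card W)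
        + n * ((2 * k) ^ k * (n ^ (q + 1) * (card (Wb b) + card (Wb b'))))"
      by (simp add: algebra_simps)
    \<comment> \<open>The second largeness assumption makes the contribution of \<open>W\<close> at
      most half of n * n^k.\<close>
    have "2 * ((2 * k) ^ k * (n ^ (q + 1) * card W)) \<le> 2 * ((2 * k) ^ k * (c * n ^ k))"
      using W' by simp
    also have "\<dots> \<le> n * n ^ k" using mult_le_mono1[OF large(2), of "n ^ k"] by (simp add: mult.assoc)
    finally have "n * n ^ k \<le> 2 * (n * ((2 * k) ^ k * (n ^ (q + 1) * (card (Wb b) + card (Wb b')))))"
      using main by linarith
    then have "n * n ^ k \<le> n * (2 * ((2 * k) ^ k * (n ^ (q + 1) * (card (Wb b) + card (Wb b')))))"
      by (simp only: mult.left_commute)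
    then have "n ^ k \<le> 2 * ((2 * k) ^ k * (n ^ (q + 1) * (card (Wb b) + card (Wb b'))))"
      using n0 by (simp only: mult_le_cancel1)
    then have "2 * n ^ k \<le> 4 * (2 * k) ^ k * (n ^ (q + 1) * card (Wb b))
        + 4 * (2 * k) ^ k * (n ^ (q + 1) * card (Wb b'))"
      by (simp add: algebra_simps)
    then have "n ^ k \<le> 4 * (2 * k) ^ k * (n ^ (q + 1) * card (Wb b)) \<or>
        n ^ k \<le> 4 * (2 * k) ^ k * (n ^ (q + 1) * card (Wb b'))" by linarith
    then show ?thesis using B mB by (auto simp: S_def)
  qed
  have finS: "finite S" using finV by (simp add: S_def)
  have "card S \<le> s"
  proof -
    \<comment> \<open>Double counting of incidences: each missing set has k - q points, so only
      boundedly many points can be popular.\<close>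
    have "(\<Sum>b\<in>V. card (Wb b)) = (\<Sum>h\<in>W. k - q)"
      unfolding Wb_def
    proof (rule sum_multicount_gen)
      show "\<forall>h\<in>W. card {b \<in> V. b \<in> h} = k - q"
      proof
        fix h assume "h \<in> W"
        then have "h \<subseteq> V" "card h = k - q" by (auto simp: W_def nsets_def)
        moreover then have "{b \<in> V. b \<in> h} = h" by blast
        ultimately show "card {b \<in> V. b \<in> h} = k - q" by simp
      qed
    qed (use finV finW in auto)
    also have "\<dots> \<le> k * card W" by simp
    finally have sum: "(\<Sum>b\<in>V. card (Wb b)) \<le> k * card W" .
    have "card S * n ^ k = (\<Sum>b\<in>S. n ^ k)" by simp
    also have "\<dots> \<le> (\<Sum>b\<in>S. 4 * (2 * k) ^ k * (n ^ (q + 1) * card (Wb b)))"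
      by (intro sum_mono) (simp add: S_def)
    also have "\<dots> \<le> (\<Sum>b\<in>V. 4 * (2 * k) ^ k * (n ^ (q + 1) * card (Wb b)))"
      using finV by (intro sum_mono2) (auto simp: S_def)
    also have "\<dots> = 4 * (2 * k) ^ k * n ^ (q + 1) * (\<Sum>b\<in>V. card (Wb b))"
      by (simp add: sum_distrib_left mult.assoc)
    also have "\<dots> \<le> 4 * (2 * k) ^ k * n ^ (q + 1) * (k * card W)" using sum by (rule mult_le_mono2)
    also have "\<dots> = 4 * (2 * k) ^ k * k * (n ^ (q + 1) * card W)" by simp
    also have "\<dots> \<le> 4 * (2 * k) ^ k * k * (c * n ^ k)" using W' by (rule mult_le_mono2)
    also have "\<dots> = s * n ^ k" by (simp add: s_def)
    finally show ?thesis using n0 by simp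
  qed
  \<comment> \<open>B has at most one point outside S, hence is determined by its trace on S and
    either nothing or one point of V.\<close>
  have "{B \<in> F. B \<inter> D = {}} \<subseteq> (\<lambda>(X, Z). X \<union> Z) ` (Pow S \<times> insert {} ((\<lambda>v. {v}) ` V))"
  proof
    fix B assume B: "B \<in> {B \<in> F. B \<inter> D = {}}"
    have "B - S \<in> insert {} ((\<lambda>v. {v}) ` V)"
    proof (cases "B - S = {}")
      case False
      then obtain v where v: "v \<in> B - S" by blast
      then have "B - S = {v}" using popular[of B v] B by blast
      moreover have "v \<in> V" using v B memF(3) by blast
      ultimately show ?thesis by simp
    qed simp
    then have "(B \<inter> S, B - S) \<in> Pow S \<times> insert {} ((\<lambda>v. {v}) ` V)" by blast
    then have "(\<lambda>(X, Z). X \<union> Z) (B \<inter> S, B - S) \<in> (\<lambda>(X, Z). X \<union> Z) ` (Pow S \<times> insert {} ((\<lambda>v. {v}) ` V))"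
      by (rule imageI)
    moreover have "(\<lambda>(X, Z). X \<union> Z) (B \<inter> S, B - S) = B" by auto
    ultimately show "B \<in> (\<lambda>(X, Z). X \<union> Z) ` (Pow S \<times> insert {} ((\<lambda>v. {v}) ` V))"
      by (simp only:)
  qed
  then have "card {B \<in> F. B \<inter> D = {}} \<le> card ((\<lambda>(X, Z). X \<union> Z) ` (Pow S \<times> insert {} ((\<lambda>v. {v}) ` V)))"
    by (rule card_mono[rotated]) (use finS finV in simp)
  also have "\<dots> \<le> card (Pow S \<times> insert {} ((\<lambda>v. {v}) ` V))"
    by (rule card_image_le) (use finS finV in simp)
  also have "\<dots> \<le> 2 ^ card S * (n + 1)"
  proof -
    have "card (insert {} ((\<lambda>v. {v}) ` V)) \<le> Suc (card ((\<lambda>v. {v}) ` V))" using finV by (simp add: card_insert_if)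
    also have "\<dots> \<le> n + 1" using card_image_le[OF finV] by simp
    finally have "2 ^ card S * card (insert {} ((\<lambda>v. {v}) ` V)) \<le> 2 ^ card S * (n + 1)" by (rule mult_le_mono2)
    then show ?thesis by (simp only: card_cartesian_product card_Pow finS)
  qed
  also have "\<dots> \<le> 2 ^ s * (n + 1)"
    using \<open>card S \<le> s\<close> by (intro mult_le_mono1 power_increasing) auto
  finally show ?thesis .
qed

text \<open>The constants follow the exceptional sets: \<open>c0\<close> is the deficit of F,
  \<open>c1\<close> bounds the uncovered sets, \<open>c2\<close> the exceptions at the pair d, a,
  and \<open>c3\<close> the missing sets at x. In \<open>c3\<close> the deficit is joined by the
  degrees of d and a and by the O(n) members that avoid the whole triple.\<close>

lemma almost_star:
  fixes c0 :: nat
  defines "c1 \<equiv> 2 * c0 + 2 * (k\<^sup>2 + 1)"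
  defines "c2 \<equiv> 2 * (k\<^sup>2 * c1 + 2)"
  defines "c3 \<equiv> c0 + 2 * (c1 + (k\<^sup>2 + 1) + 1 + c2) + 2 * 2 ^ (4 * (2 * k) ^ k * k * c2)"
  assumes many: "n ^ 2 * (n choose (k - 1)) \<le> n ^ 2 * card F + c0 * n ^ k"
    and large: "n > (2 * k) ^ k * (c2 + k\<^sup>2)" "n \<ge> 4 * k" "n \<ge> 2 * (2 * k) ^ k * c3"
  shows "\<exists>x\<in>V. card {B \<in> F. x \<notin> B} \<le> 2 ^ (4 * (2 * k) ^ k * k * c3) * (n + 1)"
proof -
  have n2: "n \<ge> 2" and kn: "k \<le> n" using large k4 by auto
  have U: "n ^ 2 * card uncovered \<le> c1 * n ^ k"
    unfolding c1_def by (rule card_uncovered_le[OF many])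
  obtain d a where da: "d \<in> V" "a \<in> V" "d \<noteq> a"
    and w: "n ^ 2 * (n ^ 2 * card {g \<in> uncovered. d \<in> g \<and> a \<in> g} + card {A \<in> F1. d \<in> own F A}
       + card {A \<in> F1. a \<in> own F A}) \<le> c2 * n ^ k"
    by (rule good_pair[OF U n2, folded c2_def])
  have w': "n ^ 4 * card {g \<in> uncovered. d \<in> g \<and> a \<in> g} + n ^ 2 * card {A \<in> F1. d \<in> own F A}
       + n ^ 2 * card {A \<in> F1. a \<in> own F A} \<le> c2 * n ^ k"
    using w by (simp add: algebra_simps flip: power_add mult.assoc)
  have "(2 * k) ^ (k - 3) * (c2 + k\<^sup>2) \<le> (2 * k) ^ k * (c2 + k\<^sup>2)"
    using k4 by (intro mult_le_mono1 power_increasing) auto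
  then have lg: "n > (2 * k) ^ (k - 3) * (c2 + k\<^sup>2)" using large by linarith
  have u: "n ^ 4 * card {g \<in> uncovered. d \<in> g \<and> a \<in> g} \<le> c2 * n ^ k" using w' by linarith
  obtain x where x: "x \<in> V" "x \<noteq> d" "x \<noteq> a"
    and W: "card {h \<in> [V - {x, d, a}]\<^bsup>(k - 3)\<^esup>. {x, d, a} \<union> h \<notin> F} \<le> card {g \<in> uncovered. d \<in> g \<and> a \<in> g}"
    by (rule common_third_vertex[OF da kn u lg])
  define e :: nat where "e = 2 ^ (4 * (2 * k) ^ k * k * c2)"
  have D3: "card {x, d, a} = 3" using x da by simp
  have "card {B \<in> F. B \<inter> {x, d, a} = {}} \<le> e * (n + 1)"
    unfolding e_def
  proof (rule blocking)
    have "n ^ 4 * card {h \<in> [V - {x, d, a}]\<^bsup>(k - 3)\<^esup>. {x, d, a} \<union> h \<notin> F} \<le> c2 * n ^ k"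
      using mult_le_mono2[OF W, of "n ^ 4"] u by linarith
    then show "n ^ (card {x, d, a} + 1) *
        card {h \<in> [V - {x, d, a}]\<^bsup>(k - card {x, d, a})\<^esup>. {x, d, a} \<union> h \<notin> F} \<le> c2 * n ^ k"
      unfolding D3 by simp
    have "c2 \<le> c3" by (simp add: c3_def)
    then show "n \<ge> 2 * (2 * k) ^ k * c2" using large(3) by (meson le_trans mult_le_mono2)
  qed (use x da large k4 D3 in auto)
  then have far: "n ^ 2 * card {B \<in> F. B \<inter> {x, d, a} = {}} \<le> 2 * e * n ^ k"
  proof -
    assume le: "card {B \<in> F. B \<inter> {x, d, a} = {}} \<le> e * (n + 1)"
    have "e * (n + 1) \<le> e * (2 * n)" using n2 by (intro mult_le_mono2) simp
    then have "n ^ 2 * card {B \<in> F. B \<inter> {x, d, a} = {}} \<le> n ^ 2 * (e * (2 * n))"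
      using le by (meson le_trans mult_le_mono2)
    also have "\<dots> = 2 * e * n ^ 3" by (simp add: power2_eq_square power3_eq_cube)
    also have "\<dots> \<le> 2 * e * n ^ k" using k4 n2 by (intro mult_le_mono2 power_increasing) auto
    finally show ?thesis .
  qed
  have deg: "n ^ 2 * card {B \<in> F. v \<in> B} \<le> (c1 + (k\<^sup>2 + 1) + 1 + c2) * n ^ k"
    if "v \<in> V" "n ^ 2 * card {A \<in> F1. v \<in> own F A} \<le> c2 * n ^ k" for v
    using degree_le[OF that(1)] U card_F0 that(2) by (simp add: algebra_simps)
  have "{B \<in> F. x \<notin> B} \<subseteq> {B \<in> F. B \<inter> {x, d, a} = {}} \<union> ({B \<in> F. d \<in> B} \<union> {B \<in> F. a \<in> B})" by blast
  then have "card {B \<in> F. x \<notin> B} \<le> card ({B \<in> F. B \<inter> {x, d, a} = {}} \<union> ({B \<in> F. d \<in> B} \<union> {B \<in> F. a \<in> B}))"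
    using finF by (intro card_mono) auto
  also have "\<dots> \<le> card {B \<in> F. B \<inter> {x, d, a} = {}} + (card {B \<in> F. d \<in> B} + card {B \<in> F. a \<in> B})"
    by (rule order_trans[OF card_Un_le add_mono[OF order_refl card_Un_le]])
  finally have "n ^ 2 * card {B \<in> F. x \<notin> B} \<le>
    n ^ 2 * (card {B \<in> F. B \<inter> {x, d, a} = {}} + (card {B \<in> F. d \<in> B} + card {B \<in> F. a \<in> B}))"
    by (rule mult_le_mono2)
  also have "\<dots> = n ^ 2 * card {B \<in> F. B \<inter> {x, d, a} = {}} + (n ^ 2 * card {B \<in> F. d \<in> B} + n ^ 2 * card {B \<in> F. a \<in> B})"
    by (simp only: distrib_left)
  also have "\<dots> \<le> 2 * e * n ^ k + ((c1 + (k\<^sup>2 + 1) + 1 + c2) * n ^ k + (c1 + (k\<^sup>2 + 1) + 1 + c2) * n ^ k)"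
    using w' by (intro add_mono far deg da) linarith+
  also have "\<dots> = (2 * e + 2 * (c1 + (k\<^sup>2 + 1) + 1 + c2)) * n ^ k"
    by (simp only: distrib_right mult_2 add.assoc)
  finally have few: "n ^ 2 * card {B \<in> F. x \<notin> B} \<le> (2 * e + 2 * (c1 + (k\<^sup>2 + 1) + 1 + c2)) * n ^ k" .
  \<comment> \<open>Missing sets and members through x are disjoint classes of (k-1)-sets. So |M| is
    at most the deficit of F plus the number of members avoiding x, and both are O(n^(k-2)).\<close>
  define M where "M = {h \<in> [V - {x}]\<^bsup>(k - 1)\<^esup>. {x} \<union> h \<notin> F}"
  have "[V]\<^bsup>(k - 1)\<^esup> \<supseteq> M" by (auto simp: M_def nsets_def)
  have "card M + card {B \<in> F. x \<in> B} \<le> n choose (k - 1)"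
  proof -
    have fin: "finite M" using finV by (simp add: M_def finite_imp_finite_nsets)
    have inj: "inj_on (\<lambda>B. B - {x}) {B \<in> F. x \<in> B}" by (rule inj_onI) blast
    have dis: "M \<inter> (\<lambda>B. B - {x}) ` {B \<in> F. x \<in> B} = {}" by (auto simp: M_def insert_absorb)
    have "card M + card {B \<in> F. x \<in> B} = card (M \<union> (\<lambda>B. B - {x}) ` {B \<in> F. x \<in> B})"
      using fin finF dis by (subst card_Un_disjoint) (auto simp: card_image[OF inj])
    also have "\<dots> \<le> card ([V]\<^bsup>(k - 1)\<^esup>)"
    proof (rule card_mono)
      show "M \<union> (\<lambda>B. B - {x}) ` {B \<in> F. x \<in> B} \<subseteq> [V]\<^bsup>(k - 1)\<^esup>"
      proof (intro Un_least image_subsetI)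
        show "M \<subseteq> [V]\<^bsup>(k - 1)\<^esup>" by fact
        fix B assume "B \<in> {B \<in> F. x \<in> B}"
        then show "B - {x} \<in> [V]\<^bsup>(k - 1)\<^esup>" using memF[of B] by (auto simp: nsets_def)
      qed
    qed (use finV in \<open>simp add: finite_imp_finite_nsets\<close>)
    finally show ?thesis by simp
  qed
  moreover have "card F = card {B \<in> F. x \<in> B} + card {B \<in> F. x \<notin> B}"
    by (rule card_filter_split[OF finF])
  ultimately have "card M + card F \<le> (n choose (k - 1)) + card {B \<in> F. x \<notin> B}" by linarith
  then have "n ^ 2 * (card M + card F) \<le> n ^ 2 * ((n choose (k - 1)) + card {B \<in> F. x \<notin> B})"
    by (rule mult_le_mono2)
  then have "n ^ 2 * card M \<le> c0 * n ^ k + n ^ 2 * card {B \<in> F. x \<notin> B}"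
    using many by (simp only: distrib_left)
  also have "\<dots> \<le> c0 * n ^ k + (2 * e + 2 * (c1 + (k\<^sup>2 + 1) + 1 + c2)) * n ^ k" using few by simp
  also have "\<dots> = c3 * n ^ k" by (simp add: c3_def e_def algebra_simps)
  finally have M: "n ^ 2 * card M \<le> c3 * n ^ k" .
  have "card {B \<in> F. B \<inter> {x} = {}} \<le> 2 ^ (4 * (2 * k) ^ k * k * c3) * (n + 1)"
  proof (rule blocking)
    show "n ^ (card {x} + 1) * card {h \<in> [V - {x}]\<^bsup>(k - card {x})\<^esup>. {x} \<union> h \<notin> F} \<le> c3 * n ^ k"
      using M by (simp add: M_def numeral_2_eq_2)
  qed (use x large k4 in auto)
  then show ?thesis using x by auto
qed

section \<open>Members through the centre\<close>

text \<open>Weighing with a large $T$ makes the contribution of the missing sets to \<open>card H\<close> arbitrarily small.\<close>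

lemma link_le_missing:
  assumes B: "B \<in> F" "x \<notin> B" and U: "U \<subseteq> V" "U \<inter> B = {}" "x \<notin> U"
  defines "H \<equiv> {e \<in> [U]\<^bsup>(k - 2)\<^esup>. \<exists>b\<in>B. insert x (insert b e) \<in> F}"
  defines "M \<equiv> {g \<in> [U]\<^bsup>(k - 1)\<^esup>. insert x g \<notin> F}"
  shows "T * card H \<le> 2 * T\<^sup>2 * n ^ (k - 3) + k\<^sup>2 * card M"
proof -
  \<comment> \<open>Each e in \<open>H\<close> is split as f + y with f of size k - 3; two different
    choices y, y' over the same f force a missing set.\<close>
  define Y where "Y f = {y \<in> U. y \<notin> f \<and> insert y f \<in> H}" for f
  let ?Fs = "[U]\<^bsup>(k - 3)\<^esup>"
  have finU: "finite U" using U finV finite_subset by blast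
  have finFs: "finite ?Fs" using finU by (simp add: finite_imp_finite_nsets)
  have finM: "finite M" using finU by (simp add: M_def finite_imp_finite_nsets)
  have finY: "finite (Y f)" for f using finU by (simp add: Y_def)
  have "H \<subseteq> (\<lambda>(f, y). insert y f) ` Sigma ?Fs Y"
  proof
    fix e assume e: "e \<in> H"
    then have "card e = k - 2" "e \<subseteq> U" "finite e" by (auto simp: H_def nsets_def)
    moreover from this obtain y where y: "y \<in> e" using k4 by fastforce
    ultimately have "(e - {y}, y) \<in> Sigma ?Fs Y" "(\<lambda>(f, y). insert y f) (e - {y}, y) = e"
      using e k4 by (auto simp: Y_def nsets_def insert_absorb)
    then show "e \<in> (\<lambda>(f, y). insert y f) ` Sigma ?Fs Y" by (metis (no_types, lifting) imageI)
  qed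
  then have "card H \<le> card ((\<lambda>(f, y). insert y f) ` Sigma ?Fs Y)"
    by (rule card_mono[rotated]) (use finFs finY in blast)
  also have "\<dots> \<le> card (Sigma ?Fs Y)" by (rule card_image_le) (use finFs finY in blast)
  also have "\<dots> = (\<Sum>f\<in>?Fs. card (Y f))" using finFs finY by simp
  finally have "T * card H \<le> (\<Sum>f\<in>?Fs. T * card (Y f))" by (simp flip: sum_distrib_left)
  also have "\<dots> \<le> (\<Sum>f\<in>?Fs. 2 * T\<^sup>2 + (card (Y f) choose 2))"
    by (intro sum_mono mult_le_choose_two)
  also have "\<dots> = 2 * T\<^sup>2 * card ?Fs + (\<Sum>f\<in>?Fs. card ([Y f]\<^bsup>2\<^esup>))"
    by (simp add: sum.distrib)
  also have "(\<Sum>f\<in>?Fs. card ([Y f]\<^bsup>2\<^esup>)) = card (SIGMA f:?Fs. [Y f]\<^bsup>2\<^esup>)"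
    by (rule card_SigmaI[symmetric]) (use finFs finY in \<open>auto simp: finite_imp_finite_nsets\<close>)
  \<comment> \<open>The missing set is f + p with p = {y, y'}. Recording p keeps the map injective,
    so each missing set is charged at most once per pair inside it.\<close>
  also have "\<dots> \<le> card (SIGMA g:M. [g]\<^bsup>2\<^esup>)"
  proof (rule card_inj_on_le[where f = "\<lambda>(f, p). (f \<union> p, p)"])
    have disj: "f \<inter> p = {}" if "p \<in> [Y f]\<^bsup>2\<^esup>" for f p using that by (auto simp: Y_def nsets_def)
    show "inj_on (\<lambda>(f, p). (f \<union> p, p)) (SIGMA f:?Fs. [Y f]\<^bsup>2\<^esup>)"
    proof (rule inj_onI)
      fix u v assume "u \<in> (SIGMA f:?Fs. [Y f]\<^bsup>2\<^esup>)" "v \<in> (SIGMA f:?Fs. [Y f]\<^bsup>2\<^esup>)"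
        "(\<lambda>(f, p). (f \<union> p, p)) u = (\<lambda>(f, p). (f \<union> p, p)) v"
      then have eq: "snd u = snd v" "fst u \<union> snd u = fst v \<union> snd v"
        and "snd u \<in> [Y (fst u)]\<^bsup>2\<^esup>" "snd v \<in> [Y (fst v)]\<^bsup>2\<^esup>" by auto
      then have "fst u \<inter> snd u = {}" "fst v \<inter> snd v = {}" using disj by blast+
      with eq have "fst u = fst v" by blast
      then show "u = v" using eq by (simp add: prod_eq_iff)
    qed
    show "(\<lambda>(f, p). (f \<union> p, p)) ` (SIGMA f:?Fs. [Y f]\<^bsup>2\<^esup>) \<subseteq> (SIGMA g:M. [g]\<^bsup>2\<^esup>)"
    proof clarify
      fix f p assume f: "f \<in> ?Fs" and p: "p \<in> [Y f]\<^bsup>2\<^esup>"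
      then obtain y y' where y: "p = {y, y'}" "y \<noteq> y'" "y \<in> Y f" "y' \<in> Y f"
        by (auto simp: nsets_def card_2_iff)
      then obtain b b' where b: "b \<in> B" "insert x (insert b (insert y f)) \<in> F"
        "b' \<in> B" "insert x (insert b' (insert y' f)) \<in> F" by (auto simp: Y_def H_def)
      have fs: "finite f" "card f = k - 3" "f \<subseteq> U" using f by (auto simp: nsets_def)
      have yU: "y \<in> U" "y' \<in> U" "y \<notin> f" "y' \<notin> f" using y by (auto simp: Y_def)
      have "insert x (insert y (insert y' f)) \<notin> F"
      proof
        assume in_F: "insert x (insert y (insert y' f)) \<in> F"
        have notB: "x \<notin> B" "y \<notin> B" "y' \<notin> B" "f \<inter> B = {}" using B U fs yU by auto
        have ne: "b \<noteq> x" "b' \<noteq> x" "b \<noteq> y" "b' \<noteq> y" "b \<noteq> y'" "b' \<noteq> y'" "b \<notin> f" "b' \<notin> f" "x \<noteq> y" "x \<noteq> y'" "x \<notin> f"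
          using b notB fs yU U by auto
        let ?A0 = "insert x (insert y (insert y' f))" and ?A1 = "insert x (insert b (insert y f))"
          and ?A2 = "insert x (insert b' (insert y' f))"
        \<comment> \<open>The points b and b' may coincide; y already separates the last two
          sets.\<close>
        have "x \<notin> B" "b \<notin> ?A0" "b' \<notin> ?A0" "y \<notin> ?A2" using ne notB yU y(2) by auto
        then have "B \<noteq> ?A0" "B \<noteq> ?A1" "B \<noteq> ?A2" "?A0 \<noteq> ?A1" "?A0 \<noteq> ?A2" "?A1 \<noteq> ?A2" by blast+
        then have dist: "distinct [B, ?A0, ?A1, ?A2]"
          by (simp only: distinct.simps list.set insert_iff empty_iff simp_thms)
        have int: "B \<inter> insert x (insert y (insert y' f)) \<inter> insert x (insert b (insert y f)) \<inter>
            insert x (insert b' (insert y' f)) = {}"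
          using notB by auto
        have "B \<union> insert x (insert y (insert y' f)) \<union> insert x (insert b (insert y f)) \<union>
            insert x (insert b' (insert y' f)) = B \<union> insert x (insert y (insert y' f))"
          using b by auto
        moreover have "card (B \<union> insert x (insert y (insert y' f))) \<le> card B + card (insert x (insert y (insert y' f)))"
          by (rule card_Un_le)
        ultimately have "card (B \<union> insert x (insert y (insert y' f)) \<union> insert x (insert b (insert y f)) \<union>
            insert x (insert b' (insert y' f))) \<le> 2 * k"
          using memF(2)[OF B(1)] memF(2)[OF in_F] by simp
        then show False using four_sets_cluster_freeD[OF cf B(1) in_F b(2) b(4) F_sub dist int] by simp
      qed
      moreover have "f \<union> p \<in> [U]\<^bsup>(k - 1)\<^esup>" using fs yU y k4 by (auto simp: nsets_def)
      moreover have "insert x (f \<union> p) = insert x (insert y (insert y' f))" using y by blast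
      ultimately show "f \<union> p \<in> M \<and> p \<in> [f \<union> p]\<^bsup>2\<^esup>" using y by (auto simp: M_def)
    qed
    show "finite (SIGMA g:M. [g]\<^bsup>2\<^esup>)"
    proof (rule finite_SigmaI[OF finM])
      fix g assume "g \<in> M"
      then show "finite ([g]\<^bsup>2\<^esup>)" by (intro finite_imp_finite_nsets) (simp add: M_def nsets_def)
    qed
  qed
  also have "\<dots> = (\<Sum>g\<in>M. (k - 1) choose 2)"
  proof -
    have g: "finite g \<and> card g = k - 1" if "g \<in> M" for g using that by (simp add: M_def nsets_def)
    then have "card (SIGMA g:M. [g]\<^bsup>2\<^esup>) = (\<Sum>g\<in>M. card ([g]\<^bsup>2\<^esup>))"
      by (intro card_SigmaI) (auto simp: finM finite_imp_finite_nsets)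
    also have "\<dots> = (\<Sum>g\<in>M. (k - 1) choose 2)" by (rule sum.cong) (simp_all add: g)
    finally show ?thesis .
  qed
  also have "\<dots> \<le> k\<^sup>2 * card M"
  proof -
    have "(k - 1) choose 2 \<le> (k - 1)\<^sup>2" by (rule binomial_le_power)
    also have "\<dots> \<le> k\<^sup>2" by (rule power_mono) auto
    finally show ?thesis by (simp add: mult.commute)
  qed
  also have "card ?Fs \<le> n ^ (k - 3)"
  proof -
    have "card ?Fs \<le> card U ^ (k - 3)" by (simp add: binomial_le_power)
    also have "\<dots> \<le> n ^ (k - 3)" using U finV by (intro power_mono card_mono) auto
    finally show ?thesis .
  qed
  finally show ?thesis by simp
qed

text \<open>Members through x are sorted by the number of points they have in S, the union of the
  blocks. Those with none share the (k-1)-subsets of U with the missing sets M. Those with one are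
  counted by \<open>link_le_missing\<close>: summed over blocks and points, the coefficient of |M|
  is k^3 nu, which the choice of T pushes below T, so they are paid for by |M| up to O(n^(k-3)).
  Those with two or more contain x and two fixed points.\<close>

lemma star_degree_le:
  assumes BB: "BB \<subseteq> F" "pairwise disjnt BB" "card BB = \<nu>" and x: "x \<in> V" "x \<notin> \<Union>BB"
  defines "T \<equiv> k ^ 3 * \<nu> + 1"
  shows "card {A \<in> F. x \<in> A} \<le> ((n - k * \<nu> - 1) choose (k - 1)) + (2 * k * \<nu> * T + (k * \<nu>)\<^sup>2) * n ^ (k - 3)"
proof -
  define S where "S = \<Union>BB"
  define U where "U = V - S - {x}"
  define M where "M = {g \<in> [U]\<^bsup>(k - 1)\<^esup>. insert x g \<notin> F}"
  define H where "H B = {e \<in> [U]\<^bsup>(k - 2)\<^esup>. \<exists>b\<in>B. insert x (insert b e) \<in> F}" for B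
  have finBB: "finite BB" using BB finF finite_subset by blast
  have mBB: "finite B" "card B = k" "B \<subseteq> V" if "B \<in> BB" for B
    using memF[of B] that BB(1) by auto
  have S: "finite S" "S \<subseteq> V" using mBB finBB unfolding S_def by blast+
  have "card S = (\<Sum>B\<in>BB. card B)"
    unfolding S_def using BB(2) mBB by (intro card_Union_disjoint)
  also have "\<dots> = (\<Sum>B\<in>BB. k)" using mBB by (intro sum.cong) auto
  finally have cS: "card S = k * \<nu>" using BB by simp
  have finU: "finite U" "U \<subseteq> V" using finV by (auto simp: U_def)
  have cU: "card U = n - k * \<nu> - 1"
    using x S finV cS by (simp add: U_def card_Diff_subset S_def)
  have finM: "finite M" using finU by (simp add: M_def finite_imp_finite_nsets)
  have finH: "finite (H B)" for B using finU by (simp add: H_def finite_imp_finite_nsets)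
  define X0 where "X0 = {A \<in> F. x \<in> A \<and> A \<inter> S = {}}"
  define X1 where "X1 = {A \<in> F. x \<in> A \<and> (\<exists>b. A \<inter> S = {b})}"
  define X2 where "X2 = {A \<in> F. x \<in> A \<and> (\<exists>b b'. b \<noteq> b' \<and> {b, b'} \<subseteq> A \<inter> S)}"
  have fX: "finite X0" "finite X1" "finite X2" using finF by (auto simp: X0_def X1_def X2_def)
  have drop_x: "A - {x} \<in> [V - {x}]\<^bsup>(k - 1)\<^esup>" if "A \<in> F" "x \<in> A" for A
    using memF[OF that(1)] that(2) by (auto simp: nsets_def)
  have "card M + card X0 \<le> (n - k * \<nu> - 1) choose (k - 1)"
  proof -
    have inj: "inj_on (\<lambda>B. B - {x}) X0" by (rule inj_onI) (auto simp: X0_def)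
    have "insert x (B - {x}) \<in> F" if "B \<in> X0" for B using that by (simp add: X0_def insert_absorb)
    then have dis: "M \<inter> (\<lambda>B. B - {x}) ` X0 = {}" by (auto simp: M_def)
    have "card M + card X0 = card (M \<union> (\<lambda>B. B - {x}) ` X0)"
      using finM fX dis by (subst card_Un_disjoint) (auto simp: card_image[OF inj])
    also have "\<dots> \<le> card ([U]\<^bsup>(k - 1)\<^esup>)"
    proof (rule card_mono)
      show "M \<union> (\<lambda>B. B - {x}) ` X0 \<subseteq> [U]\<^bsup>(k - 1)\<^esup>"
      proof (intro Un_least image_subsetI)
        show "M \<subseteq> [U]\<^bsup>(k - 1)\<^esup>" by (auto simp: M_def)
        fix B assume "B \<in> X0"
        then show "B - {x} \<in> [U]\<^bsup>(k - 1)\<^esup>" using drop_x[of B] by (auto simp: X0_def U_def nsets_def)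
      qed
    qed (use finU in \<open>simp add: finite_imp_finite_nsets\<close>)
    finally show ?thesis using cU by simp
  qed
  moreover have "card X1 \<le> 2 * k * \<nu> * T * n ^ (k - 3) + card M"
  proof -
    have sub: "X1 \<subseteq> (\<Union>B\<in>BB. (\<lambda>(b, e). insert x (insert b e)) ` (B \<times> H B))"
    proof
      fix A assume "A \<in> X1"
      then obtain b where A: "A \<in> F" "x \<in> A" "A \<inter> S = {b}" by (auto simp: X1_def)
      then obtain B where B: "B \<in> BB" "b \<in> B" by (auto simp: S_def)
      define e where "e = A - {x} - {b}"
      have bx: "b \<noteq> x" using A x by (auto simp: S_def)
      have eq: "A = insert x (insert b e)" using A by (auto simp: e_def)
      have "b \<in> A - {x}" using A bx by blast
      then have "card e = k - 2" using memF[OF A(1)] A(2) by (simp add: e_def)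
      then have "e \<in> [U]\<^bsup>(k - 2)\<^esup>" using memF[OF A(1)] A by (auto simp: e_def U_def nsets_def)
      then have "e \<in> H B" using B A eq by (auto simp: H_def)
      then show "A \<in> (\<Union>B\<in>BB. (\<lambda>(b, e). insert x (insert b e)) ` (B \<times> H B))"
        using B eq by force
    qed
    have "card X1 \<le> card (\<Union>B\<in>BB. (\<lambda>(b, e). insert x (insert b e)) ` (B \<times> H B))"
      by (rule card_mono[OF _ sub]) (use finBB finH mBB in auto)
    also have "\<dots> \<le> (\<Sum>B\<in>BB. card ((\<lambda>(b, e). insert x (insert b e)) ` (B \<times> H B)))"
      by (rule card_UN_le[OF finBB])
    also have "\<dots> \<le> (\<Sum>B\<in>BB. k * card (H B))"
    proof (rule sum_mono)
      fix B assume "B \<in> BB"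
      then have B: "finite B" "card B = k" using BB memF by auto
      then have "card ((\<lambda>(b, e). insert x (insert b e)) ` (B \<times> H B)) \<le> card (B \<times> H B)"
        by (intro card_image_le) (simp add: finH)
      then show "card ((\<lambda>(b, e). insert x (insert b e)) ` (B \<times> H B)) \<le> k * card (H B)"
        using B by (simp add: card_cartesian_product)
    qed
    finally have "T * card X1 \<le> T * (\<Sum>B\<in>BB. k * card (H B))" by (rule mult_le_mono2)
    also have "\<dots> = (\<Sum>B\<in>BB. k * (T * card (H B)))" by (simp add: sum_distrib_left mult.left_commute)
    also have "\<dots> \<le> (\<Sum>B\<in>BB. k * (2 * T\<^sup>2 * n ^ (k - 3) + k\<^sup>2 * card M))"
    proof (intro sum_mono mult_le_mono2)
      fix B assume B: "B \<in> BB"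
      then have "B \<in> F" "x \<notin> B" "U \<inter> B = {}" using BB x by (auto simp: U_def S_def)
      then show "T * card (H B) \<le> 2 * T\<^sup>2 * n ^ (k - 3) + k\<^sup>2 * card M"
        unfolding H_def M_def using finU by (intro link_le_missing) (auto simp: U_def)
    qed
    also have "\<dots> = T * (2 * k * \<nu> * T * n ^ (k - 3)) + k ^ 3 * \<nu> * card M"
      using BB(3) by (simp add: algebra_simps power2_eq_square power3_eq_cube)
    also have "\<dots> \<le> T * (2 * k * \<nu> * T * n ^ (k - 3)) + T * card M" by (simp add: T_def)
    finally have "T * card X1 \<le> T * (2 * k * \<nu> * T * n ^ (k - 3) + card M)" by (simp only: distrib_left)
    moreover have "T > 0" by (simp add: T_def)
    ultimately show ?thesis by (simp only: mult_le_cancel1)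
  qed
  moreover have "card X2 \<le> (k * \<nu>)\<^sup>2 * n ^ (k - 3)"
  proof -
    let ?I = "{(b, b') \<in> S \<times> S. b \<noteq> b'}"
    let ?W = "\<lambda>(b, b'). {A \<in> [V]\<^bsup>k\<^esup>. {x, b, b'} \<subseteq> A}"
    have finI: "finite ?I" using S by (auto intro: finite_subset[of _ "S \<times> S"])
    have "X2 \<subseteq> (\<Union>p\<in>?I. ?W p)" using F_sub by (auto simp: X2_def)
    then have "card X2 \<le> card (\<Union>p\<in>?I. ?W p)"
      by (rule card_mono[rotated]) (use finI finV in \<open>auto simp: finite_imp_finite_nsets\<close>)
    then have "card X2 * n ^ 3 \<le> card (\<Union>p\<in>?I. ?W p) * n ^ 3" by (rule mult_le_mono1)
    also have "\<dots> \<le> card ?I * n ^ k"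
    proof (rule card_UN_mult_le[OF finI])
      fix p assume "p \<in> ?I"
      then obtain b b' where p: "p = (b, b')" "b \<in> S" "b' \<in> S" "b \<noteq> b'" by auto
      then have "card {x, b, b'} = 3" using x by (auto simp: S_def card_insert_if)
      then show "card (?W p) * n ^ 3 \<le> n ^ k"
        using card_nsets_supset_le[OF finV, of k "{x, b, b'}"] p(1) by (simp only: prod.case)
    qed
    also have "card ?I \<le> card (S \<times> S)" using S by (intro card_mono) auto
    also have "\<dots> = (k * \<nu>)\<^sup>2" by (simp add: card_cartesian_product cS power2_eq_square)
    also have "n ^ k = n ^ 3 * n ^ (k - 3)" using k4 by (simp flip: power_add)
    finally have "n ^ 3 * card X2 \<le> n ^ 3 * ((k * \<nu>)\<^sup>2 * n ^ (k - 3))" by (simp add: mult_ac)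
    moreover have "n > 0" using x finV card_gt_0_iff by blast
    ultimately show ?thesis by (simp only: mult_le_cancel1 zero_less_power)
  qed
  moreover have "{A \<in> F. x \<in> A} \<subseteq> X0 \<union> X1 \<union> X2"
  proof
    fix A assume A: "A \<in> {A \<in> F. x \<in> A}"
    consider "A \<inter> S = {}" | b where "A \<inter> S = {b}" | b b' where "b \<noteq> b'" "{b, b'} \<subseteq> A \<inter> S" by blast
    then show "A \<in> X0 \<union> X1 \<union> X2" using A unfolding X0_def X1_def X2_def by cases blast+
  qed
  then have "card {A \<in> F. x \<in> A} \<le> card (X0 \<union> X1 \<union> X2)" by (rule card_mono[rotated]) (use fX in simp)
  moreover have "card (X0 \<union> X1 \<union> X2) \<le> card X0 + card X1 + card X2"
    by (rule order_trans[OF card_Un_le add_mono[OF card_Un_le order_refl]])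
  ultimately have "card {A \<in> F. x \<in> A} \<le> ((n - k * \<nu> - 1) choose (k - 1)) +
      (2 * k * \<nu> * T * n ^ (k - 3) + (k * \<nu>)\<^sup>2 * n ^ (k - 3))" by linarith
  then show ?thesis by (simp only: distrib_right)
qed

end

section \<open>The upper bound for all large n\<close>

lemma card_cluster_free_le:
  fixes k \<nu> :: nat
  assumes "k \<ge> 4"
  shows "\<exists>c N. \<forall>n \<ge> N. \<forall>F M. F \<subseteq> [{1..n}]\<^bsup>k\<^esup> \<longrightarrow> d_cluster_free 4 k F \<longrightarrow>
    M \<subseteq> F \<longrightarrow> pairwise disjnt M \<longrightarrow> \<nu> + 1 \<le> card M \<longrightarrow>
    card F \<le> ((n - k * \<nu> - 1) choose (k - 1)) + c * ((n - k * \<nu> - 1) choose (k - 3))"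
proof -
  \<comment> \<open>\<open>c0\<close> is the number of points outside the star's ground set, and
    \<open>c1\<close> to \<open>K\<close> are the constants of \<open>almost_star\<close> for this
    deficit. \<open>L\<close> comes from \<open>star_degree_le\<close>.\<close>
  define c0 where "c0 = k * \<nu> + 1"
  define c1 where "c1 = 2 * c0 + 2 * (k\<^sup>2 + 1)"
  define c2 where "c2 = 2 * (k\<^sup>2 * c1 + 2)"
  define c3 where "c3 = c0 + 2 * (c1 + (k\<^sup>2 + 1) + 1 + c2) + 2 * 2 ^ (4 * (2 * k) ^ k * k * c2)"
  define K :: nat where "K = 2 ^ (4 * (2 * k) ^ k * k * c3)"
  define L where "L = 2 * k * \<nu> * (k ^ 3 * \<nu> + 1) + (k * \<nu>)\<^sup>2"
  define N where "N = (2 * k) ^ k * (c2 + k\<^sup>2) + 4 * k + 2 * (2 * k) ^ k * c3 + 2 * c0 + 1"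
  show ?thesis
  proof (intro exI allI impI)
    fix n and F M :: "nat set set"
    assume n: "N \<le> n" and F: "F \<subseteq> [{1..n}]\<^bsup>k\<^esup>" "d_cluster_free 4 k F"
      and M: "M \<subseteq> F" "pairwise disjnt M" "\<nu> + 1 \<le> card M"
    let ?m = "n - k * \<nu> - 1"
    have m: "?m = n - c0" by (simp add: c0_def)
    interpret cluster_free_family "{1..n}" k F using F assms by unfold_locales auto
    have cn: "card {1..n} = n" by simp
    show "card F \<le> (?m choose (k - 1)) + ((L + 2 * K) * (2 * k) ^ (k - 3)) * (?m choose (k - 3))"
    proof (cases "card F \<le> ?m choose (k - 1)")
      \<comment> \<open>A family not exceeding the star needs no argument. A larger one has deficit
        at most c0 n^(k-2) against binom(n, k-1), which is what \<open>almost_star\<close>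
        requires.\<close>
      case False
      have "Suc (k - 2) = k - 1" "2 + (k - 2) = k" using assms by auto
      have "n choose (k - 1) \<le> (?m choose (k - 1)) + c0 * n ^ (k - 2)"
        using binomial_diff_le[of n "k - 2" c0] \<open>Suc (k - 2) = k - 1\<close> by (simp only: m)
      then have "n choose (k - 1) \<le> card F + c0 * n ^ (k - 2)" using False by simp
      then have "n ^ 2 * (n choose (k - 1)) \<le> n ^ 2 * (card F + c0 * n ^ (k - 2))" by (rule mult_le_mono2)
      also have "\<dots> = n ^ 2 * card F + c0 * (n ^ 2 * n ^ (k - 2))" by (simp add: distrib_left)
      also have "n ^ 2 * n ^ (k - 2) = n ^ k"
        using \<open>2 + (k - 2) = k\<close> by (metis power_add)
      finally have many: "n ^ 2 * (n choose (k - 1)) \<le> n ^ 2 * card F + c0 * n ^ k" .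
      have large: "n > (2 * k) ^ k * (c2 + k\<^sup>2)" "n \<ge> 4 * k" "n \<ge> 2 * (2 * k) ^ k * c3" "n \<ge> 2 * c0"
        using n by (auto simp: N_def)
      obtain x where x: "x \<in> {1..n}" "card {B \<in> F. x \<notin> B} \<le> K * (n + 1)"
        using almost_star[of c0, unfolded cn, OF many] large
        unfolding c1_def[symmetric] c2_def[symmetric] c3_def[symmetric] K_def[symmetric] by blast
      have finM: "finite M" using M finF finite_subset by blast
      \<comment> \<open>Disjoint sets cannot share x, so at least nu of the nu + 1 members of M
        avoid the centre and serve as blocks.\<close>
      have "card {B \<in> M. x \<in> B} \<le> 1"
      proof -
        have eq: "B = B'" if "B \<in> {B \<in> M. x \<in> B}" "B' \<in> {B \<in> M. x \<in> B}" for B B'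
          using that M(2) by (auto simp: pairwise_def disjnt_def)
        show ?thesis unfolding One_nat_def
          by (subst card_le_Suc0_iff_eq) (use finM eq in \<open>simp, blast\<close>)
      qed
      then have "\<nu> \<le> card {B \<in> M. x \<notin> B}" using card_filter_split[OF finM, of "\<lambda>B. x \<in> B"] M(3) by simp
      then obtain BB where BB: "BB \<subseteq> {B \<in> M. x \<notin> B}" "card BB = \<nu>" using obtain_subset_with_card_n by blast
      have "pairwise disjnt BB" using BB M(2) pairwise_subset by blast
      then have "card {A \<in> F. x \<in> A} \<le> (?m choose (k - 1)) + L * n ^ (k - 3)"
        using star_degree_le[of BB \<nu> x] BB M(1) x(1) unfolding L_def cn by blast
      \<comment> \<open>Here k >= 4 lets the linear bound disappear in n^(k-3).\<close>
      moreover have "card {B \<in> F. x \<notin> B} \<le> 2 * K * n ^ (k - 3)"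
      proof -
        have "n \<ge> 1" using x by simp
        then have "n + 1 \<le> 2 * n ^ 1" by simp
        also have "\<dots> \<le> 2 * n ^ (k - 3)" using \<open>n \<ge> 1\<close> assms by (intro mult_le_mono2 power_increasing) auto
        finally have "K * (n + 1) \<le> K * (2 * n ^ (k - 3))" by (rule mult_le_mono2)
        then show ?thesis using x(2) by (simp add: mult_ac)
      qed
      ultimately have "card F \<le> (?m choose (k - 1)) + (L + 2 * K) * n ^ (k - 3)"
        using card_filter_split[OF finF, of "\<lambda>B. x \<in> B"] by (simp add: distrib_right)
      moreover have "n ^ (k - 3) \<le> (2 * k) ^ (k - 3) * (?m choose (k - 3))"
        unfolding m using large by (intro power_le_binomial) auto
      then have "(L + 2 * K) * n ^ (k - 3) \<le> (L + 2 * K) * ((2 * k) ^ (k - 3) * (?m choose (k - 3)))"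
        by (rule mult_le_mono2)
      ultimately show ?thesis by (simp only: mult.assoc)
    qed simp
  qed
qed

section \<open>Constructions\<close>

lemma finite_admissible_cards:
  assumes "finite X" shows "finite {card M | M. M \<subseteq> X \<and> P M}"
  using assms by (auto intro: finite_subset[of _ "card ` Pow X"])

lemma matching_number_ge_iff:
  assumes "finite F"
  shows "m \<le> matching_number F \<longleftrightarrow> (\<exists>M\<subseteq>F. pairwise disjnt M \<and> m \<le> card M)"
proof -
  have "{} \<subseteq> F \<and> pairwise disjnt ({} :: 'a set set)" by simp
  then have "{card M | M. M \<subseteq> F \<and> pairwise disjnt M} \<noteq> {}" by blast
  then show ?thesis
    unfolding matching_number_def using finite_admissible_cards[OF assms] by (subst Max_ge_iff) auto
qed

lemma card_le_max_cluster_free: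
  assumes "F \<subseteq> [{1..n}]\<^bsup>k\<^esup>" "d_cluster_free d k F" "M \<subseteq> F" "pairwise disjnt M" "\<nu> + 1 \<le> card M"
  shows "card F \<le> max_cluster_free n k d \<nu>"
proof -
  have "finite F" using assms(1) by (rule finite_subset) (simp add: finite_imp_finite_nsets)
  then have "\<nu> + 1 \<le> matching_number F" using assms by (auto simp: matching_number_ge_iff)
  then show ?thesis
    unfolding max_cluster_free_def using assms
    by (intro Max_ge finite_admissible_cards) (auto simp: finite_imp_finite_nsets)
qed

text \<open>\<open>Max\<close> says nothing about an empty set, so an admissible family has to be
  supplied before a maximiser can be chosen.\<close>

lemma max_cluster_free_attained:
  assumes F0: "F0 \<subseteq> [{1..n}]\<^bsup>k\<^esup>" "d_cluster_free d k F0" "M0 \<subseteq> F0" "pairwise disjnt M0" "\<nu> + 1 \<le> card M0"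
  obtains F M where "F \<subseteq> [{1..n}]\<^bsup>k\<^esup>" "d_cluster_free d k F" "M \<subseteq> F" "pairwise disjnt M"
    "\<nu> + 1 \<le> card M" "card F = max_cluster_free n k d \<nu>"
proof -
  have "finite F0" using F0(1) by (rule finite_subset) (simp add: finite_imp_finite_nsets)
  then have "\<nu> + 1 \<le> matching_number F0" using F0 by (auto simp: matching_number_ge_iff)
  then have "max_cluster_free n k d \<nu> \<in>
    {card F | F. F \<subseteq> [{1..n}]\<^bsup>k\<^esup> \<and> d_cluster_free d k F \<and> \<nu> + 1 \<le> matching_number F}"
    unfolding max_cluster_free_def using assms
    by (intro Max_in finite_admissible_cards) (auto simp: finite_imp_finite_nsets)
  then obtain F where F: "F \<subseteq> [{1..n}]\<^bsup>k\<^esup>" "d_cluster_free d k F" "\<nu> + 1 \<le> matching_number F"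
    "card F = max_cluster_free n k d \<nu>" by auto
  have "finite F" using F(1) by (rule finite_subset) (simp add: finite_imp_finite_nsets)
  then obtain M where "M \<subseteq> F" "pairwise disjnt M" "\<nu> + 1 \<le> card M"
    using F(3) matching_number_ge_iff by blast
  then show thesis using that F by blast
qed

section \<open>A star together with disjoint blocks\<close>

text \<open>A cluster cannot lie inside G, where x is common. Two blocks would already use up all 2k
  points and leave no room for x, while a third block would be disjoint from both and hence empty.
  So a cluster consists of one block and three members of G, which together have at most k points
  outside the block.\<close>

lemma d_cluster_free_star_blocks:
  assumes G: "\<And>A. A \<in> G \<Longrightarrow> x \<in> A"
    and BB: "BB \<subseteq> [V]\<^bsup>k\<^esup>" "pairwise disjnt BB" "x \<notin> \<Union>BB" and "k > 0"
    and crit: "\<And>B Q. B \<in> BB \<Longrightarrow> Q \<subseteq> G \<Longrightarrow> card Q = 3 \<Longrightarrow> card (\<Union>Q - B) \<le> k \<Longrightarrow> B \<inter> \<Inter>Q \<noteq> {}"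
  shows "d_cluster_free 4 k (G \<union> BB)"
  unfolding d_cluster_free_def
proof clarify
  fix C assume C: "C \<subseteq> G \<union> BB" "d_cluster 4 k C"
  then have cl: "finite C" "card C = 4" "card (\<Union>C) \<le> 2 * k" "\<Inter>C = {}"
    and fin: "\<And>A. A \<in> C \<Longrightarrow> finite A" by (auto simp: d_cluster_def nsets_def)
  have finU: "finite (\<Union>C)" using cl(1) fin by blast
  have mB: "finite B" "card B = k" if "B \<in> BB" for B using that BB(1) by (auto simp: nsets_def)
  have "\<not> C \<subseteq> G" using G cl(4) by blast
  then obtain B where B: "B \<in> C" "B \<in> BB" using C(1) by blast
  have others: "B' \<in> G" if "B' \<in> C" "B' \<noteq> B" for B'
  proof (rule ccontr)
    assume "B' \<notin> G"
    then have B': "B' \<in> BB" using that C(1) by blast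
    have disj: "B \<inter> B' = {}" using B B' that BB(2) by (auto simp: pairwise_def disjnt_def)
    then have "card (B \<union> B') = 2 * k" using mB B B' by (simp add: card_Un_disjoint)
    moreover have "B \<union> B' \<subseteq> \<Union>C" using B that by blast
    ultimately have UC: "\<Union>C = B \<union> B'" using cl(3) finU by (metis card_seteq)
    have "card {B, B'} < card C" using cl(2) card_insert_le_m1[of 2 "{B'}" B] by (auto simp: card_insert_if)
    then have "\<not> C \<subseteq> {B, B'}" using card_mono[of "{B, B'}" C] by auto
    then obtain B'' where B'': "B'' \<in> C" "B'' \<noteq> B" "B'' \<noteq> B'" by blast
    have "B'' \<in> BB"
    proof (rule ccontr)
      assume "B'' \<notin> BB"
      then have "x \<in> \<Union>C" using B'' C(1) G by blast
      then show False using UC B B' BB(3) by blast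
    qed
    then have "B'' \<inter> B = {}" "B'' \<inter> B' = {}" using B'' B B' BB(2) by (auto simp: pairwise_def disjnt_def)
    then have "B'' = {}" using UC B'' by blast
    then show False using mB[OF \<open>B'' \<in> BB\<close>] \<open>k > 0\<close> by simp
  qed
  have "C - {B} \<subseteq> G" "card (C - {B}) = 3" using others B cl by auto
  moreover have "card (\<Union>(C - {B}) - B) \<le> k"
  proof -
    have "\<Union>(C - {B}) - B = \<Union>C - B" by blast
    moreover have "card (\<Union>C - B) = card (\<Union>C) - card B" using B mB by (intro card_Diff_subset) auto
    ultimately show ?thesis using cl(3) mB[OF B(2)] by simp
  qed
  ultimately have "B \<inter> \<Inter>(C - {B}) \<noteq> {}" using crit B by blast
  moreover have "B \<inter> \<Inter>(C - {B}) = \<Inter>C" using B by blast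
  ultimately show False using cl(4) by simp
qed

text \<open>A member of Q disjoint from B fills the whole of \<Union>Q - B, since both sizes are
  governed by k. Hence at most one member avoids B; it is named A3 if it exists.\<close>

lemma three_sets_meeting_block:
  assumes Q: "card Q = 3" "\<And>A. A \<in> Q \<Longrightarrow> finite A \<and> card A = k" and le: "card (\<Union>Q - B) \<le> k"
  obtains A1 A2 A3 where "Q = {A1, A2, A3}" "A1 \<noteq> A2" "A1 \<noteq> A3" "A2 \<noteq> A3"
    "A1 \<inter> B \<noteq> {}" "A2 \<inter> B \<noteq> {}" "A3 \<inter> B = {} \<longrightarrow> A3 = \<Union>Q - B"
proof -
  have finQ: "finite Q" using Q(1) by (simp add: card_ge_0_finite)
  have fin: "finite (\<Union>Q - B)" using finQ Q(2) by blast
  have avoid: "A = \<Union>Q - B" if "A \<in> Q" "A \<inter> B = {}" for A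
    using that Q(2)[of A] le fin by (intro card_seteq) auto
  obtain A1 A2 A3 where A: "Q = {A1, A2, A3}" "A1 \<noteq> A2" "A1 \<noteq> A3" "A2 \<noteq> A3"
    using Q(1) by (auto simp: card_3_iff)
  consider "A1 \<inter> B = {}" | "A2 \<inter> B = {}" | "A1 \<inter> B \<noteq> {}" "A2 \<inter> B \<noteq> {}" by blast
  then show thesis
  proof cases
    case 1
    then have "A2 \<inter> B \<noteq> {}" "A3 \<inter> B \<noteq> {}" using avoid[of A1] avoid[of A2] avoid[of A3] A by auto
    moreover have "A1 = \<Union>Q - B" using 1 A by (intro avoid) auto
    ultimately show thesis using A by (intro that[of A2 A3 A1]) auto
  next
    case 2
    then have "A1 \<inter> B \<noteq> {}" "A3 \<inter> B \<noteq> {}" using avoid[of A1] avoid[of A2] avoid[of A3] A by auto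
    moreover have "A2 = \<Union>Q - B" using 2 A by (intro avoid) auto
    ultimately show thesis using A by (intro that[of A1 A3 A2]) auto
  next
    case 3
    then show thesis using A avoid[of A3] by (intro that[of A1 A2 A3]) auto
  qed
qed

text \<open>Layout of {1..n} with n = m + 1 + k nu: the set U is {1..m}, the centre x is m + 1, and
  the blocks follow consecutively from m + 2 on.\<close>

definition block :: "nat \<Rightarrow> nat \<Rightarrow> nat \<Rightarrow> nat set" where
  "block k m i = (\<lambda>j. m + 2 + k * i + j) ` {..<k}"

lemma block_point_inject:
  fixes k m i j i' j' :: nat
  assumes "m + 2 + k * i + j = m + 2 + k * i' + j'" "j < k" "j' < k"
  shows "i = i' \<and> j = j'"
proof -
  have eq: "k * i + j = k * i' + j'" using assms(1) by simp
  have "(k * i + j) div k = i" if "j < k" for i j using that by simp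
  then have "i = i'" using eq assms(2,3) by metis
  then show ?thesis using eq by simp
qed

lemma block_point_le:
  fixes i j k m \<nu> :: nat
  assumes "i < \<nu>" "j < k"
  shows "m + 2 + k * i + j \<le> m + 1 + k * \<nu>"
proof -
  have "k * (i + 1) \<le> k * \<nu>" using assms by (intro mult_le_mono2) simp
  then show ?thesis using assms by simp
qed

text \<open>The bound on n gives m >= k - 1, so some star set lies inside {1..m+1}; with the blocks
  it forms nu + 1 disjoint members. The assumption \<open>crit\<close> is the one case of a cluster
  that depends on G.\<close>

lemma star_with_blocks:
  fixes k \<nu> n :: nat
  defines "m \<equiv> n - k * \<nu> - 1"
  defines "BB \<equiv> block k m ` {..<\<nu>}"
  assumes k: "k > 0" and n: "k * (\<nu> + 1) \<le> n"
    and G: "G \<subseteq> [{1..n}]\<^bsup>k\<^esup>" "\<And>A. A \<in> G \<Longrightarrow> m + 1 \<in> A" "insert (m + 1) ` [{1..m}]\<^bsup>(k - 1)\<^esup> \<subseteq> G"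
    and crit: "\<And>B Q. B \<in> BB \<Longrightarrow> Q \<subseteq> G \<Longrightarrow> card Q = 3 \<Longrightarrow> card (\<Union>Q - B) \<le> k \<Longrightarrow> B \<inter> \<Inter>Q \<noteq> {}"
  shows "\<exists>F M. F \<subseteq> [{1..n}]\<^bsup>k\<^esup> \<and> d_cluster_free 4 k F \<and> M \<subseteq> F \<and> pairwise disjnt M \<and>
    \<nu> + 1 \<le> card M \<and> card F = card G + \<nu>"
proof -
  have nm: "n = m + 1 + k * \<nu>" "k - 1 \<le> m" using n k by (auto simp: m_def)
  have inj: "inj_on (\<lambda>j. m + 2 + k * i + j) {..<k}" for i by (auto simp: inj_on_def)
  have block_bounds: "m + 1 < v \<and> v \<le> n" if v: "v \<in> block k m i" "i < \<nu>" for v i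
    using v block_point_le[of i \<nu> _ k m] nm by (auto simp: block_def)
  have disj: "block k m i \<inter> block k m i' = {}" if "i \<noteq> i'" for i i'
  proof (rule ccontr)
    assume "\<not> ?thesis"
    then obtain j j' where "m + 2 + k * i + j = m + 2 + k * i' + j'" "j < k" "j' < k" by (auto simp: block_def)
    then show False using block_point_inject that by blast
  qed
  have card_block: "card (block k m i) = k" for i
    unfolding block_def by (simp only: card_image[OF inj] card_lessThan)
  have BB: "BB \<subseteq> [{1..n}]\<^bsup>k\<^esup>"
  proof
    fix B assume "B \<in> BB"
    then obtain i where i: "i < \<nu>" "B = block k m i" by (auto simp: BB_def)
    have "B \<subseteq> {1..n}" using block_bounds[OF _ i(1)] i(2) by fastforce
    then show "B \<in> [{1..n}]\<^bsup>k\<^esup>" using i(2) card_block[of i] by (simp add: nsets_def block_def)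
  qed
  have pw: "pairwise disjnt BB"
  proof (rule pairwiseI)
    fix B B' assume "B \<in> BB" "B' \<in> BB" "B \<noteq> B'"
    then obtain i i' where "B = block k m i" "B' = block k m i'" "i \<noteq> i'" by (auto simp: BB_def)
    then show "disjnt B B'" using disj by (simp add: disjnt_def)
  qed
  have "inj_on (block k m) {..<\<nu>}"
  proof (rule inj_onI)
    fix i i' assume "block k m i = block k m i'"
    then have "i \<noteq> i' \<Longrightarrow> block k m i = {}" using disj[of i i'] by simp
    then show "i = i'" using card_block[of i] k by fastforce
  qed
  then have cBB: "card BB = \<nu>" by (simp add: BB_def card_image)
  have x: "m + 1 \<notin> \<Union>BB" using block_bounds by (force simp: BB_def)
  obtain g where g: "g \<in> [{1..m}]\<^bsup>(k - 1)\<^esup>"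
    using nm(2) nsets_eq_empty_iff[of "{1..m}" "k - 1"] by fastforce
  define M where "M = insert (insert (m + 1) g) BB"
  have "disjnt (insert (m + 1) g) B" if "B \<in> BB" for B
    using g that block_bounds by (force simp: disjnt_def BB_def nsets_def)
  then have "pairwise disjnt M" using pw by (auto simp: M_def pairwise_insert disjnt_sym)
  moreover have "M \<subseteq> G \<union> BB" using g G(3) by (auto simp: M_def)
  moreover have finBB: "finite BB" by (simp add: BB_def)
  then have "\<nu> + 1 \<le> card M" using x cBB by (simp add: M_def card_insert_if) blast
  moreover have "d_cluster_free 4 k (G \<union> BB)"
    using G(2) BB pw x k crit by (rule d_cluster_free_star_blocks)
  moreover have "G \<union> BB \<subseteq> [{1..n}]\<^bsup>k\<^esup>" using G(1) BB by blast
  moreover have "card (G \<union> BB) = card G + \<nu>"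
  proof -
    have "G \<inter> BB = {}" using G(2) x by blast
    moreover have "finite G" using G(1) by (rule finite_subset) (simp add: finite_imp_finite_nsets)
    ultimately show ?thesis using finBB cBB by (simp add: card_Un_disjoint)
  qed
  ultimately show ?thesis by blast
qed

text \<open>The blocks are split into two halves, and points of the same position $j$ in blocks of
  different halves may be used together; within a block such a point is determined by its partner.\<close>

lemma large_cluster_free_family:
  fixes k \<nu> n :: nat
  defines "m \<equiv> n - k * \<nu> - 1"
  assumes k: "k \<ge> 4" and n: "k * (\<nu> + 1) \<le> n"
  shows "\<exists>F M. F \<subseteq> [{1..n}]\<^bsup>k\<^esup> \<and> d_cluster_free 4 k F \<and> M \<subseteq> F \<and> pairwise disjnt M \<and>
    \<nu> + 1 \<le> card M \<and>
    (m choose (k - 1)) + k * ((\<nu> div 2) * (\<nu> - \<nu> div 2)) * (m choose (k - 3)) \<le> card F"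
proof -
  define p where "p = \<nu> div 2"
  define b where "b c j = m + 2 + k * c + j" for c j
  define S where "S = {m + 2..n}"
  define G where "G = {A \<in> [{1..n}]\<^bsup>k\<^esup>. m + 1 \<in> A \<and> (A \<inter> S = {} \<or>
    (\<exists>c d j. c < \<nu> \<and> d < \<nu> \<and> j < k \<and> (c < p) \<noteq> (d < p) \<and> A \<inter> S = {b c j, b d j}))}"
  let ?star = "insert (m + 1) ` [{1..m}]\<^bsup>(k - 1)\<^esup>"
  have nm: "n = m + 1 + k * \<nu>" using n k by (auto simp: m_def)
  have b_inj: "b c j = b d j' \<longleftrightarrow> c = d \<and> j = j'" if "j < k" "j' < k" for c d j j'
    using that block_point_inject[of m k c j d j'] by (auto simp: b_def)
  have b_S: "b c j \<in> S" if "c < \<nu>" "j < k" for c j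
    using block_point_le[OF that, of m] nm by (auto simp: b_def S_def)
  have S_le: "m + 1 < v" if "v \<in> S" for v using that by (simp add: S_def)
  have pair_inj: "{b c j, b d j} = {b c' j', b d' j'} \<longleftrightarrow> j = j' \<and> (c = c' \<and> d = d' \<or> c = d' \<and> d = c')"
    if "j < k" "j' < k" for c d j c' d' j'
    using that by (auto simp: doubleton_eq_iff b_inj)
  have finG: "finite G"
    by (rule finite_subset[of _ "[{1..n}]\<^bsup>k\<^esup>"]) (auto simp: G_def finite_imp_finite_nsets)
  have star: "?star \<subseteq> G"
  proof
    fix A assume "A \<in> ?star"
    then obtain g where g: "g \<subseteq> {1..m}" "finite g" "card g = k - 1" "A = insert (m + 1) g"
      by (auto simp: nsets_def)
    then have "m + 1 \<notin> g" "A \<inter> S = {}" by (auto simp: S_def)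
    then show "A \<in> G" using g k nm by (auto simp: G_def nsets_def)
  qed
  have "\<exists>F M. F \<subseteq> [{1..n}]\<^bsup>k\<^esup> \<and> d_cluster_free 4 k F \<and> M \<subseteq> F \<and> pairwise disjnt M \<and>
      \<nu> + 1 \<le> card M \<and> card F = card G + \<nu>"
    unfolding G_def
  proof (rule star_with_blocks[where k = k and n = n and \<nu> = \<nu>, folded m_def])
    fix B Q assume B: "B \<in> block k m ` {..<\<nu>}" and le: "card (\<Union>Q - B) \<le> k"
      and Q: "Q \<subseteq> {A \<in> [{1..n}]\<^bsup>k\<^esup>. m + 1 \<in> A \<and> (A \<inter> S = {} \<or>
        (\<exists>c d j. c < \<nu> \<and> d < \<nu> \<and> j < k \<and> (c < p) \<noteq> (d < p) \<and> A \<inter> S = {b c j, b d j}))}" "card Q = 3"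
    obtain c where c: "c < \<nu>" "B = block k m c" using B by auto
    have QG: "Q \<subseteq> G" using Q(1) by (simp add: G_def)
    have mem: "finite A" "card A = k" "A \<subseteq> {1..n}" if "A \<in> Q" for A
      using that QG by (auto simp: G_def nsets_def)
    have G_cases: "A \<inter> S = {} \<or> (\<exists>c d j. c < \<nu> \<and> d < \<nu> \<and> j < k \<and> (c < p) \<noteq> (d < p) \<and> A \<inter> S = {b c j, b d j})"
      if "A \<in> Q" for A
      using subsetD[OF QG that] unfolding G_def mem_Collect_eq by (elim conjE)
    \<comment> \<open>A member of Q that meets B puts k - 1 points into Z: its k - 2 points outside
      S and its partner point. As Z has at most k points, there is room for only one more.\<close>
    define Z where "Z = \<Union>Q - B"
    have "Z \<subseteq> {1..n}" using mem(3) by (auto simp: Z_def)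
    then have finZ: "finite Z" using finite_subset by blast
    have cZ: "card Z \<le> k" using le by (simp add: Z_def)
    have B_eq: "B = b c ` {..<k}" unfolding c(2) block_def by (rule image_cong) (simp_all add: b_def)
    then have B_S: "B \<subseteq> S" using b_S c by auto
    have b_B: "b d j \<in> B \<longleftrightarrow> d = c" if "j < k" for d j
      using that b_inj by (auto simp: B_eq)
    have meet: "\<exists>d j. d < \<nu> \<and> j < k \<and> (c < p) \<noteq> (d < p) \<and> A \<inter> S = {b c j, b d j}"
      if AB: "A \<in> Q" "A \<inter> B \<noteq> {}" for A
    proof -
      have "A \<inter> S \<noteq> {}" using AB B_S by blast
      then obtain c' d j where A: "c' < \<nu>" "d < \<nu>" "j < k" "(c' < p) \<noteq> (d < p)" "A \<inter> S = {b c' j, b d j}"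
        using G_cases[OF AB(1)] by blast
      have "A \<inter> B = {b c' j, b d j} \<inter> B" using A(5) B_S by blast
      then have "c' = c \<or> d = c" using AB(2) b_B[OF A(3)] by auto
      then show ?thesis
      proof
        assume "c' = c" then show ?thesis using A by blast
      next
        assume "d = c"
        then have "A \<inter> S = {b c j, b c' j}" "(c < p) \<noteq> (c' < p)" using A by auto
        then show ?thesis using A by blast
      qed
    qed
    have trace: "b d j \<in> Z" "b d j \<notin> A - S" "A - S \<subseteq> Z" "finite (A - S)" "card (A - S) = k - 2"
      if "A \<in> Q" "d < \<nu>" "j < k" "(c < p) \<noteq> (d < p)" "A \<inter> S = {b c j, b d j}" for A d j
    proof -
      have ne: "b c j \<noteq> b d j" using b_inj that by auto
      have "b d j \<in> A" using that(5) by blast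
      then show "b d j \<in> Z" using that b_B[OF that(3), of d] by (auto simp: Z_def)
      show "b d j \<notin> A - S" using that(5) by blast
      show "A - S \<subseteq> Z" using that(1) B_S by (auto simp: Z_def)
      show "finite (A - S)" using mem that by simp
      have "card (A - S) = card A - card (A \<inter> S)" using mem(1)[OF that(1)] by (simp add: card_Diff_subset_Int)
      then show "card (A - S) = k - 2" using mem(2)[OF that(1)] that(5) ne by simp
    qed
    obtain A1 A2 A3 where A: "Q = {A1, A2, A3}" "A1 \<noteq> A2" "A1 \<noteq> A3" "A2 \<noteq> A3"
      "A1 \<inter> B \<noteq> {}" "A2 \<inter> B \<noteq> {}" "A3 \<inter> B = {} \<longrightarrow> A3 = Z"
      using three_sets_meeting_block[OF Q(2) _ le] mem unfolding Z_def by metis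
    have A_Q: "A1 \<in> Q" "A2 \<in> Q" "A3 \<in> Q" using A(1) by auto
    obtain d1 j1 where 1: "d1 < \<nu>" "j1 < k" "(c < p) \<noteq> (d1 < p)" "A1 \<inter> S = {b c j1, b d1 j1}"
      using meet[OF A_Q(1) A(5)] by blast
    obtain d2 j2 where 2: "d2 < \<nu>" "j2 < k" "(c < p) \<noteq> (d2 < p)" "A2 \<inter> S = {b c j2, b d2 j2}"
      using meet[OF A_Q(2) A(6)] by blast
    note t1 = trace[OF A_Q(1) 1] and t2 = trace[OF A_Q(2) 2]
    have split: "A = A'" if "A \<inter> S = A' \<inter> S" "A - S = A' - S" for A A' :: "nat set"
      using that by blast
    have bS: "b d1 j1 \<in> S" "b d2 j2 \<in> S" using b_S 1 2 by auto
    show "B \<inter> \<Inter>Q \<noteq> {}"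
    proof (cases "d1 = d2 \<and> j1 = j2")
      \<comment> \<open>With a common partner, A1 and A2 differ outside S, and that difference takes
        the last place in Z. So Z has a single point in S, A3 must have the same partner too, and
        all three sets share the point of B at position j1.\<close>
      case True
      then have "A1 - S \<noteq> A2 - S" using split 1 2 A(2) by metis
      then have "\<not> A2 - S \<subseteq> A1 - S"
        using card_subset_eq[OF t1(4), of "A2 - S"] t1(5) t2(5) by auto
      then have "A1 - S \<subset> (A1 - S) \<union> (A2 - S)" by blast
      then have "card (A1 - S) < card ((A1 - S) \<union> (A2 - S))"
        by (rule psubset_card_mono[rotated]) (use t1(4) t2(4) in blast)
      then have "k - 2 < card ((A1 - S) \<union> (A2 - S))" using t1(5) by simp
      moreover have "b d1 j1 \<notin> (A1 - S) \<union> (A2 - S)" using bS by blast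
      ultimately have "k \<le> card (insert (b d1 j1) ((A1 - S) \<union> (A2 - S)))"
        using t1 t2 by simp
      moreover have "insert (b d1 j1) ((A1 - S) \<union> (A2 - S)) \<subseteq> Z" using t1(1,3) t2(3) by simp
      ultimately have "insert (b d1 j1) ((A1 - S) \<union> (A2 - S)) = Z"
        using finZ cZ by (intro card_seteq) auto
      then have ZS: "Z \<inter> S = {b d1 j1}" using bS by blast
      have "A3 \<inter> B \<noteq> {}"
      proof
        assume "A3 \<inter> B = {}"
        then have eq: "A3 \<inter> S = {b d1 j1}" using A ZS by simp
        obtain c' d' j' where "j' < k" "(c' < p) \<noteq> (d' < p)" "{b d1 j1} = {b c' j', b d' j'}"
          using G_cases[OF A_Q(3)] unfolding eq by blast
        then have "b c' j' = b d' j'" by auto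
        then show False using b_inj[of j' j' c' d'] \<open>j' < k\<close> \<open>(c' < p) \<noteq> (d' < p)\<close> by simp
      qed
      then obtain d3 j3 where 3: "d3 < \<nu>" "j3 < k" "(c < p) \<noteq> (d3 < p)" "A3 \<inter> S = {b c j3, b d3 j3}"
        using meet[OF A_Q(3)] by blast
      then have "b d3 j3 \<in> Z \<inter> S" using trace(1)[OF A_Q(3) 3] b_S[OF 3(1,2)] by simp
      then have "j3 = j1" using ZS b_inj 1 3 by auto
      then have "b c j1 \<in> A1 \<inter> S" "b c j1 \<in> A2 \<inter> S" "b c j1 \<in> A3 \<inter> S"
        unfolding 1(4) 2(4) 3(4) using True by simp_all
      then show ?thesis using A(1) b_B[OF 1(2), of c] by auto
    next
      \<comment> \<open>Two different partners fill Z, so A1 and A2 agree outside S. If A3 avoids B,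
        it equals Z, and its trace on S consists of two points from the half opposite to c, which is
        not permitted. If A3 meets B, its partner is one of the two and A3 equals A1 or A2.\<close>
      case False
      then have ne: "b d1 j1 \<noteq> b d2 j2" using b_inj 1 2 by simp
      have "k = card (insert (b d1 j1) (insert (b d2 j2) (A1 - S)))"
        using t1 bS ne k by simp
      moreover have "insert (b d1 j1) (insert (b d2 j2) (A1 - S)) \<subseteq> Z" using t1(1,3) t2(1) by simp
      ultimately have Z: "insert (b d1 j1) (insert (b d2 j2) (A1 - S)) = Z"
        using finZ cZ by (intro card_seteq) auto
      have ZS: "Z \<inter> S = {b d1 j1, b d2 j2}" "Z - S = A1 - S" unfolding Z[symmetric] using bS by blast+
      have same: "A - S = A1 - S" if "A - S \<subseteq> Z" "card (A - S) = k - 2" for A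
      proof (rule card_subset_eq[OF t1(4)])
        show "A - S \<subseteq> A1 - S" using that(1) unfolding ZS(2)[symmetric] by auto
      qed (use that(2) t1(5) in simp)
      have False
      proof (cases "A3 \<inter> B = {}")
        case True
        then have eq: "A3 \<inter> S = {b d1 j1, b d2 j2}" using A ZS by simp
        obtain c' d' j' where h: "j' < k" "(c' < p) \<noteq> (d' < p)" "{b d1 j1, b d2 j2} = {b c' j', b d' j'}"
          using G_cases[OF A_Q(3)] unfolding eq by blast
        then have "d1 = c' \<and> d2 = d' \<or> d1 = d' \<and> d2 = c'"
          using b_inj 1 2 by (auto simp: doubleton_eq_iff)
        then show False using h(2) 1(3) 2(3) by auto
      next
        case False
        then obtain d3 j3 where 3: "d3 < \<nu>" "j3 < k" "(c < p) \<noteq> (d3 < p)" "A3 \<inter> S = {b c j3, b d3 j3}"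
          using meet[OF A_Q(3)] by blast
        note t3 = trace[OF A_Q(3) 3]
        have "b d3 j3 \<in> Z \<inter> S" using t3(1) b_S[OF 3(1,2)] by simp
        then have "A3 \<inter> S = A1 \<inter> S \<or> A3 \<inter> S = A2 \<inter> S" using ZS b_inj 1 2 3 by auto
        moreover have "A3 - S = A1 - S" "A2 - S = A1 - S" using same[OF t3(3,5)] same[OF t2(3,5)] by simp_all
        ultimately have "A3 = A1 \<or> A3 = A2" using split[of A3] by metis
        then show False using A(3,4) by blast
      qed
      then show ?thesis ..
    qed
  qed (use k n star in \<open>auto simp: G_def\<close>)
  moreover have "(m choose (k - 1)) + k * (p * (\<nu> - p)) * (m choose (k - 3)) \<le> card G"
  proof -
    \<comment> \<open>With c in the first half and d in the second, each unordered pair of blocks is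
      listed once, although the condition in \<open>G\<close> is symmetric in c and d.\<close>
    let ?I = "({..<p} \<times> {p..<\<nu>} \<times> {..<k}) \<times> [{1..m}]\<^bsup>(k - 3)\<^esup>"
    let ?f = "\<lambda>((c, d, j), f). insert (m + 1) (insert (b c j) (insert (b d j) f))"
    have f_props: "?f q \<inter> S = {b c j, b d j}" "?f q \<inter> {1..m} = f" "f \<subseteq> {1..m}" "finite f" "card f = k - 3"
        "c < p" "p \<le> d" "c < \<nu>" "d < \<nu>" "j < k"
      if "q \<in> ?I" "q = ((c, d, j), f)" for q c d j f
    proof -
      show f: "f \<subseteq> {1..m}" "finite f" "card f = k - 3" and cd: "c < p" "p \<le> d" "d < \<nu>" "j < k"
        using that by (auto simp: nsets_def)
      then show "c < \<nu>" by simp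
      then have "b c j \<in> S" "b d j \<in> S" using b_S cd by auto
      moreover from this have "b c j \<notin> {1..m}" "b d j \<notin> {1..m}"
        using S_le[of "b c j"] S_le[of "b d j"] by auto
      moreover have "f \<inter> S = {}" "m + 1 \<notin> S" using f(1) by (auto simp: S_def)
      ultimately show "?f q \<inter> S = {b c j, b d j}" "?f q \<inter> {1..m} = f"
        unfolding that(2) prod.case using f(1) by auto
    qed
    have inj: "inj_on ?f ?I"
    proof (rule inj_onI)
      fix q q' assume q: "q \<in> ?I" "q' \<in> ?I" "?f q = ?f q'"
      obtain c d j f where q1: "q = ((c, d, j), f)" by (metis prod.exhaust)
      obtain c' d' j' f' where q2: "q' = ((c', d', j'), f')" by (metis prod.exhaust)
      note P = f_props[OF q(1) q1] and P' = f_props[OF q(2) q2]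
      have "f = f'" "{b c j, b d j} = {b c' j', b d' j'}" using P(1,2) P'(1,2) q(3) by simp_all
      then have "f = f'" "c = c'" "d = d'" "j = j'" using pair_inj P P' by auto
      then show "q = q'" using q1 q2 by simp
    qed
    have cross: "?f ` ?I \<subseteq> G"
    proof
      fix A assume "A \<in> ?f ` ?I"
      then obtain q where q: "q \<in> ?I" "A = ?f q" by blast
      obtain c d j f where q1: "q = ((c, d, j), f)" by (metis prod.exhaust)
      note P = f_props[OF q(1) q1]
      have bs: "b c j \<in> S" "b d j \<in> S" using b_S P by auto
      have ne: "b c j \<noteq> b d j" using b_inj P by auto
      have A: "A = insert (m + 1) (insert (b c j) (insert (b d j) f))" using q q1 by simp
      have "m + 1 \<notin> f" "b c j \<notin> f" "b d j \<notin> f" "b c j \<noteq> m + 1" "b d j \<noteq> m + 1"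
        using P(3) S_le[OF bs(1)] S_le[OF bs(2)] by force+
      then have "card A = k" using A ne P(4,5) k by simp
      moreover have "A \<subseteq> {1..n}" using A P(3) bs nm by (auto simp: S_def)
      ultimately have "A \<in> [{1..n}]\<^bsup>k\<^esup>" using A P(4) by (simp add: nsets_def)
      moreover have "A \<inter> S = {b c j, b d j}" using P(1) q by simp
      moreover have "(c < p) \<noteq> (d < p)" using P by simp
      ultimately show "A \<in> G" using A P(8-10) unfolding G_def by blast
    qed
    have "?star \<inter> ?f ` ?I = {}"
    proof (rule Int_emptyI)
      fix A assume "A \<in> ?star" "A \<in> ?f ` ?I"
      then obtain q where q: "A = ?f q" "q \<in> ?I" by (elim imageE)
      obtain c d j f where q1: "q = ((c, d, j), f)" by (metis prod.exhaust)
      have "A \<inter> S = {}" using \<open>A \<in> ?star\<close> by (auto simp: nsets_def S_def)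
      then show False using f_props(1)[OF q(2) q1] q(1) by simp
    qed
    moreover have "inj_on (insert (m + 1)) ([{1..m}]\<^bsup>(k - 1)\<^esup>)"
    proof (rule inj_onI)
      fix g g' :: "nat set" assume g: "g \<in> [{1..m}]\<^bsup>(k - 1)\<^esup>" "g' \<in> [{1..m}]\<^bsup>(k - 1)\<^esup>"
        and eq: "insert (m + 1) g = insert (m + 1) g'"
      have "m + 1 \<notin> g" "m + 1 \<notin> g'" using g by (auto simp: nsets_def)
      then show "g = g'" using eq by (simp add: insert_ident)
    qed
    then have "card ?star = m choose (k - 1)" by (simp add: card_image)
    moreover have "card (?f ` ?I) = k * (p * (\<nu> - p)) * (m choose (k - 3))"
      using inj by (simp add: card_image card_cartesian_product)
    ultimately have "card (?star \<union> ?f ` ?I) = (m choose (k - 1)) + k * (p * (\<nu> - p)) * (m choose (k - 3))"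
      using finite_subset[OF star finG] finite_subset[OF cross finG] by (simp only: card_Un_disjoint)
    moreover have "card (?star \<union> ?f ` ?I) \<le> card G" using star cross finG by (intro card_mono) auto
    ultimately show ?thesis by simp
  qed
  ultimately show ?thesis unfolding p_def by (metis trans_le_add1)
qed

section \<open>Tight paths with two edges and the case of one block\<close>

text \<open>The two edges share r - 1 vertices. These are placed at positions 2 to r in any order,
  with the private vertices y and y' at the ends 1 and r + 1.\<close>

lemma is_tight_path_two:
  fixes e e' :: "'a set"
  assumes fin: "finite e" "finite e'" and card: "card e = r" "card e' = r" and "e \<noteq> e'" "card (e \<union> e') \<le> r + 1"
  shows "is_tight_path 2 r {e, e'}"
proof -
  have "card (e - e') = card (e \<union> e') - card e'"
    using fin by (simp add: card_Un_disjoint flip: card_Diff_subset) (metis Un_Diff Diff_cancel Un_empty_right)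
  moreover have "card (e' - e) = card (e \<union> e') - card e"
    using fin by (simp flip: card_Diff_subset) (metis Un_Diff Diff_cancel Un_empty_left)
  ultimately have "card (e - e') \<le> 1" "card (e' - e) \<le> 1" using assms by auto
  moreover have "\<not> e \<subseteq> e'" "\<not> e' \<subseteq> e"
    using card_subset_eq[of e' e] card_subset_eq[of e e'] assms by auto
  ultimately have "card (e - e') = 1" "card (e' - e) = 1"
    using fin by (auto simp: le_Suc_eq)
  then obtain y y' where y: "e - e' = {y}" "e' - e = {y'}" by (auto simp: card_1_singleton_iff)
  define f where "f = e \<inter> e'"
  have e: "e = insert y f" "e' = insert y' f" "y \<notin> f" "y' \<notin> f" "y \<noteq> y'" using y by (auto simp: f_def)
  have "finite f" using fin by (simp add: f_def)
  then have "card {2..<r + 1} = card f" using e card by auto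
  then obtain h where h: "bij_betw h {2..<r + 1} f"
    using finite_same_card_bij[of "{2..<r + 1}" f] \<open>finite f\<close> by auto
  have r: "r > 0" using e card \<open>finite f\<close> by auto
  define v where "v i = (if i = 1 then y else if i = r + 1 then y' else h i)" for i
  have vh: "v i = h i" if "i \<in> {2..<r + 1}" for i using that by (auto simp: v_def)
  have v1: "v 1 = y" "v (r + 1) = y'" using r by (auto simp: v_def)
  have img: "v ` {2..<r + 1} = f" using h vh by (simp add: bij_betw_def)
  have split: "{1..<1 + r} = insert 1 {2..<r + 1}" "{2..<2 + r} = insert (r + 1) {2..<r + 1}"
    "{1..<2 + r} = insert 1 (insert (r + 1) {2..<r + 1})"
    using r by auto
  have "inj_on v {2..<r + 1}" using h vh by (auto simp: bij_betw_def inj_on_def)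
  then have "inj_on v {1..<2 + r}"
    unfolding split(3) using e v1 img r by (auto simp: inj_on_insert)
  moreover have "v ` {1..<1 + r} = e" "v ` {2..<2 + r} = e'"
    unfolding split image_insert img v1 using e by simp_all
  moreover have "{v ` {i..<i + r} | i. 1 \<le> i \<and> i \<le> (2::nat)} = {v ` {1..<1 + r}, v ` {2..<2 + r}}"
  proof -
    have "{v ` {i..<i + r} | i. 1 \<le> i \<and> i \<le> (2::nat)} = (\<lambda>i. v ` {i..<i + r}) ` {i. 1 \<le> i \<and> i \<le> 2}"
      by blast
    also have "{i. 1 \<le> i \<and> i \<le> (2::nat)} = {1, 2}" by auto
    finally show ?thesis by simp
  qed
  ultimately show ?thesis unfolding is_tight_path_def by (intro exI[of _ v]) simp
qed

text \<open>For l = 0 the empty edge set would itself be a path, no H would be admissible and the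
  maximum would range over nothing.\<close>

lemma ex_tight_path_attained:
  assumes "l > 0"
  obtains H where "H \<subseteq> [{1..m}]\<^bsup>r\<^esup>" "\<not> (\<exists>P\<subseteq>H. is_tight_path l r P)" "card H = ex_tight_path m l r"
proof -
  have "\<not> is_tight_path l r ({} :: nat set set)" using assms by (auto simp: is_tight_path_def)
  then have "({} :: nat set set) \<subseteq> [{1..m}]\<^bsup>r\<^esup> \<and> \<not> (\<exists>P\<subseteq>({} :: nat set set). is_tight_path l r P)" by simp
  then have "{card H | H. H \<subseteq> [{1..m}]\<^bsup>r\<^esup> \<and> \<not> (\<exists>P\<subseteq>H. is_tight_path l r P)} \<noteq> {}" by blast
  then have "ex_tight_path m l r \<in> {card H | H. H \<subseteq> [{1..m}]\<^bsup>r\<^esup> \<and> \<not> (\<exists>P\<subseteq>H. is_tight_path l r P)}"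
    unfolding ex_tight_path_def by (intro Max_in finite_admissible_cards) (simp add: finite_imp_finite_nsets)
  then show thesis using that by auto
qed

text \<open>Only one point m + 2 of the block is used: the sets e of an extremal H are extended by m
  + 1 and m + 2. In a critical triple two members meet the block. Their parts e, e' and the point m
  + 1 have at most k points in all, so e and e' together have at most (k - 2) + 1 and form a tight
  path in H. The final 1 counts the block itself.\<close>

lemma max_cluster_free_one_ge:
  fixes k n :: nat
  defines "m \<equiv> n - k - 1"
  assumes k: "k \<ge> 4" and n: "2 * k \<le> n"
  shows "(m choose (k - 1)) + ex_tight_path m 2 (k - 2) + 1 \<le> max_cluster_free n k 4 1"
proof -
  obtain H where H: "H \<subseteq> [{1..m}]\<^bsup>(k - 2)\<^esup>" "\<not> (\<exists>P\<subseteq>H. is_tight_path 2 (k - 2) P)"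
    "card H = ex_tight_path m 2 (k - 2)"
    using ex_tight_path_attained[of 2 m "k - 2"] by auto
  define S where "S = block k m 0"
  define G where "G = {A \<in> [{1..n}]\<^bsup>k\<^esup>. m + 1 \<in> A \<and> (A \<inter> S = {} \<or> A \<inter> S = {m + 2} \<and> A - {m + 1, m + 2} \<in> H)}"
  let ?star = "insert (m + 1) ` [{1..m}]\<^bsup>(k - 1)\<^esup>"
  let ?f = "\<lambda>e. insert (m + 1) (insert (m + 2) e)"
  have nm: "n = m + 1 + k" using n k by (auto simp: m_def)
  have S: "m + 2 \<in> S" "S \<inter> {1..m + 1} = {}"
    using k by (auto simp: S_def block_def image_iff intro: bexI[of _ 0])
  have finG: "finite G"
    by (rule finite_subset[of _ "[{1..n}]\<^bsup>k\<^esup>"]) (auto simp: G_def finite_imp_finite_nsets)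
  have memH: "e \<subseteq> {1..m}" "finite e" "card e = k - 2" "m + 1 \<notin> e" "m + 2 \<notin> e" if "e \<in> H" for e
    using subsetD[OF H(1) that] by (auto simp: nsets_def)
  have star: "?star \<subseteq> G"
  proof
    fix A assume "A \<in> ?star"
    then obtain g where g: "g \<subseteq> {1..m}" "finite g" "card g = k - 1" "A = insert (m + 1) g"
      by (auto simp: nsets_def)
    then have "m + 1 \<notin> g" "A \<subseteq> {1..m + 1}" by auto
    moreover from this have "A \<inter> S = {}" using S(2) by blast
    ultimately show "A \<in> G" using g k nm by (auto simp: G_def nsets_def)
  qed
  have trace: "?f e \<inter> S = {m + 2}" "?f e - {m + 1, m + 2} = e" if "e \<in> H" for e
  proof -
    have "e \<subseteq> {1..m + 1}" "m + 1 \<in> {1..m + 1}" using memH[OF that] by auto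
    then show "?f e \<inter> S = {m + 2}" using S by blast
    show "?f e - {m + 1, m + 2} = e" using memH[OF that] by auto
  qed
  have "\<exists>F M. F \<subseteq> [{1..n}]\<^bsup>k\<^esup> \<and> d_cluster_free 4 k F \<and> M \<subseteq> F \<and> pairwise disjnt M \<and>
      1 + 1 \<le> card M \<and> card F = card G + 1"
    unfolding G_def
  proof (rule star_with_blocks[where k = k and n = n and \<nu> = 1, unfolded mult_1_right, folded m_def])
    fix B Q assume B: "B \<in> block k m ` {..<1}" and le: "card (\<Union>Q - B) \<le> k"
      and Q: "Q \<subseteq> {A \<in> [{1..n}]\<^bsup>k\<^esup>. m + 1 \<in> A \<and>
        (A \<inter> S = {} \<or> A \<inter> S = {m + 2} \<and> A - {m + 1, m + 2} \<in> H)}" "card Q = 3"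
    have BS: "B = S" using B by (auto simp: S_def)
    have mem: "finite A \<and> card A = k" "A \<subseteq> {1..n}" "m + 1 \<in> A"
      "A \<inter> S = {} \<or> A \<inter> S = {m + 2} \<and> A - {m + 1, m + 2} \<in> H" if "A \<in> Q" for A
      using subsetD[OF Q(1) that] by (auto simp: nsets_def)
    obtain A1 A2 A3 where A: "Q = {A1, A2, A3}" "A1 \<noteq> A2" "A1 \<inter> B \<noteq> {}" "A2 \<inter> B \<noteq> {}"
      using three_sets_meeting_block[OF Q(2) mem(1) le] by metis
    have A_Q: "A1 \<in> Q" "A2 \<in> Q" using A(1) by auto
    define e where "e A = A - {m + 1, m + 2}" for A :: "nat set"
    have part: "e A \<in> H" "A - B = insert (m + 1) (e A)" "A = ?f (e A)" if "A \<in> Q" "A \<inter> B \<noteq> {}" for A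
    proof -
      have AS: "A \<inter> S = {m + 2}" "e A \<in> H" using mem(4)[OF that(1)] that(2) BS by (auto simp: e_def)
      then show "e A \<in> H" by simp
      show "A = ?f (e A)" using mem(3)[OF that(1)] AS by (auto simp: e_def)
      have "m + 1 \<notin> S" using S(2) by auto
      then show "A - B = insert (m + 1) (e A)" using mem(3)[OF that(1)] AS unfolding BS e_def by blast
    qed
    note p1 = part[OF A_Q(1) A(3)] and p2 = part[OF A_Q(2) A(4)]
    have ne: "e A1 \<noteq> e A2" using p1(3) p2(3) A(2) by metis
    have "insert (m + 1) (e A1 \<union> e A2) = (A1 - B) \<union> (A2 - B)" using p1(2) p2(2) by simp
    also have "\<dots> \<subseteq> \<Union>Q - B" using A_Q by blast
    finally have "card (insert (m + 1) (e A1 \<union> e A2)) \<le> card (\<Union>Q - B)"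
    proof (rule card_mono[rotated])
      have "\<Union>Q - B \<subseteq> {1..n}" using mem(2) by blast
      then show "finite (\<Union>Q - B)" using finite_subset by blast
    qed
    moreover have "card (insert (m + 1) (e A1 \<union> e A2)) = card (e A1 \<union> e A2) + 1"
      using memH[OF p1(1)] memH[OF p2(1)] by simp
    ultimately have "card (e A1 \<union> e A2) \<le> (k - 2) + 1" using le k by simp
    then have "is_tight_path 2 (k - 2) {e A1, e A2}"
      using memH[OF p1(1)] memH[OF p2(1)] ne by (intro is_tight_path_two) auto
    moreover have "{e A1, e A2} \<subseteq> H" using p1(1) p2(1) by simp
    ultimately have False using H(2) by blast
    then show "B \<inter> \<Inter>Q \<noteq> {}" ..
  qed (use k n star in \<open>auto simp: G_def\<close>)
  then obtain F M where F: "F \<subseteq> [{1..n}]\<^bsup>k\<^esup>" "d_cluster_free 4 k F" "M \<subseteq> F" "pairwise disjnt M"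
    "1 + 1 \<le> card M" "card F = card G + 1" by blast
  have "(m choose (k - 1)) + card H \<le> card G"
  proof -
    have cross: "?f ` H \<subseteq> G"
    proof (rule image_subsetI)
      fix e assume e: "e \<in> H"
      then have "?f e \<in> [{1..n}]\<^bsup>k\<^esup>" using memH[OF e] k nm by (auto simp: nsets_def)
      then show "?f e \<in> G" using trace[OF e] e by (simp add: G_def)
    qed
    have "?star \<inter> ?f ` H = {}"
    proof (rule Int_emptyI)
      fix A assume "A \<in> ?star" "A \<in> ?f ` H"
      then obtain g e where "g \<subseteq> {1..m}" "A = insert (m + 1) g" "A = ?f e" by (auto simp: nsets_def)
      then have "m + 2 \<in> insert (m + 1) g" by blast
      then show False using \<open>g \<subseteq> {1..m}\<close> by auto
    qed
    moreover have "inj_on (insert (m + 1)) ([{1..m}]\<^bsup>(k - 1)\<^esup>)"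
    proof (rule inj_onI)
      fix g g' :: "nat set" assume g: "g \<in> [{1..m}]\<^bsup>(k - 1)\<^esup>" "g' \<in> [{1..m}]\<^bsup>(k - 1)\<^esup>"
        and eq: "insert (m + 1) g = insert (m + 1) g'"
      have "m + 1 \<notin> g" "m + 1 \<notin> g'" using g by (auto simp: nsets_def)
      then show "g = g'" using eq by (simp add: insert_ident)
    qed
    then have "card ?star = m choose (k - 1)" by (simp add: card_image)
    moreover have "inj_on ?f H" using trace(2) by (rule inj_on_inverseI)
    then have "card (?f ` H) = card H" by (rule card_image)
    ultimately have "card (?star \<union> ?f ` H) = (m choose (k - 1)) + card H"
      using finite_subset[OF star finG] finite_subset[OF cross finG] by (simp only: card_Un_disjoint)
    moreover have "card (?star \<union> ?f ` H) \<le> card G" using star cross finG by (intro card_mono) auto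
    ultimately show ?thesis by simp
  qed
  then show ?thesis using card_le_max_cluster_free[OF F(1-5)] F(6) H(3) by simp
qed

section \<open>The quarter-square constant and the combination of the bounds\<close>

lemma floor_square_quarter: "\<lfloor>(real \<nu>)\<^sup>2 / 4\<rfloor> = int ((\<nu> div 2) * (\<nu> - \<nu> div 2))"
proof -
  define p where "p = \<nu> div 2"
  have "\<nu> = 2 * p \<or> \<nu> = 2 * p + 1" by (auto simp: p_def)
  then show ?thesis
  proof
    assume "\<nu> = 2 * p"
    then show ?thesis by (intro floor_unique) (simp_all add: power2_eq_square)
  next
    assume "\<nu> = 2 * p + 1"
    then show ?thesis by (intro floor_unique) (simp_all add: power2_eq_square algebra_simps add_divide_distrib)
  qed
qed

theorem theorem1p7:
  fixes k \<nu> :: nat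
  assumes "k \<ge> 4"
  shows "(\<exists>c\<^sub>1 c\<^sub>2 :: real.
            c\<^sub>1 \<ge> real k * real_of_int \<lfloor>(real \<nu>)\<^sup>2 / 4\<rfloor> \<and>
            c\<^sub>2 \<ge> real k * real_of_int \<lfloor>(real \<nu>)\<^sup>2 / 4\<rfloor> \<and>
            (\<forall>n \<ge> k * (\<nu> + 1).
               real (max_cluster_free n k 4 \<nu>) \<ge>
                 real ((n - k * \<nu> - 1) choose (k - 1)) +
                 c\<^sub>1 * real ((n - k * \<nu> - 1) choose (k - 3))) \<and>
            (\<forall>\<^sub>F n in sequentially.
               real (max_cluster_free n k 4 \<nu>) \<le>
                 real ((n - k * \<nu> - 1) choose (k - 1)) +
                 c\<^sub>2 * real ((n - k * \<nu> - 1) choose (k - 3)))) \<and>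
         (\<nu> = 1 \<longrightarrow>
            (\<forall>n \<ge> 2 * k.
               max_cluster_free n k 4 1 \<ge>
                 ((n - k - 1) choose (k - 1)) + ex_tight_path (n - k - 1) 2 (k - 2) + 1))"
proof (intro conjI impI allI)
  define a where "a = k * ((\<nu> div 2) * (\<nu> - \<nu> div 2))"
  have a: "real k * real_of_int \<lfloor>(real \<nu>)\<^sup>2 / 4\<rfloor> = real a"
    unfolding floor_square_quarter a_def by simp
  have lower: "((n - k * \<nu> - 1) choose (k - 1)) + a * ((n - k * \<nu> - 1) choose (k - 3)) \<le> max_cluster_free n k 4 \<nu>"
    if n: "n \<ge> k * (\<nu> + 1)" for n
  proof -
    obtain F M where F: "F \<subseteq> [{1..n}]\<^bsup>k\<^esup>" "d_cluster_free 4 k F" "M \<subseteq> F" "pairwise disjnt M" "\<nu> + 1 \<le> card M"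
      and "((n - k * \<nu> - 1) choose (k - 1)) + a * ((n - k * \<nu> - 1) choose (k - 3)) \<le> card F"
      using large_cluster_free_family[OF assms n] unfolding a_def by blast
    then show ?thesis using card_le_max_cluster_free[OF F] by linarith
  qed
  obtain c N where upper: "\<forall>n \<ge> N. \<forall>F M. F \<subseteq> [{1..n}]\<^bsup>k\<^esup> \<longrightarrow> d_cluster_free 4 k F \<longrightarrow>
      M \<subseteq> F \<longrightarrow> pairwise disjnt M \<longrightarrow> \<nu> + 1 \<le> card M \<longrightarrow>
      card F \<le> ((n - k * \<nu> - 1) choose (k - 1)) + c * ((n - k * \<nu> - 1) choose (k - 3))"
    using card_cluster_free_le[OF assms, of \<nu>] by (elim exE)
  have upper': "max_cluster_free n k 4 \<nu> \<le>
      ((n - k * \<nu> - 1) choose (k - 1)) + (c + a) * ((n - k * \<nu> - 1) choose (k - 3))"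
    if n: "n \<ge> N" "n \<ge> k * (\<nu> + 1)" for n
  proof -
    \<comment> \<open>The constructed family ensures that the maximum is attained.\<close>
    obtain F0 M0 where F0: "F0 \<subseteq> [{1..n}]\<^bsup>k\<^esup>" "d_cluster_free 4 k F0" "M0 \<subseteq> F0" "pairwise disjnt M0" "\<nu> + 1 \<le> card M0"
      using large_cluster_free_family[OF assms n(2)] by blast
    obtain F M where F: "F \<subseteq> [{1..n}]\<^bsup>k\<^esup>" "d_cluster_free 4 k F" "M \<subseteq> F" "pairwise disjnt M" "\<nu> + 1 \<le> card M"
      and max: "card F = max_cluster_free n k 4 \<nu>"
      by (rule max_cluster_free_attained[OF F0])
    show ?thesis using upper[rule_format, OF n(1) F] unfolding max by (simp add: distrib_right)
  qed
  show "\<exists>c\<^sub>1 c\<^sub>2 :: real.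
            c\<^sub>1 \<ge> real k * real_of_int \<lfloor>(real \<nu>)\<^sup>2 / 4\<rfloor> \<and>
            c\<^sub>2 \<ge> real k * real_of_int \<lfloor>(real \<nu>)\<^sup>2 / 4\<rfloor> \<and>
            (\<forall>n \<ge> k * (\<nu> + 1).
               real (max_cluster_free n k 4 \<nu>) \<ge>
                 real ((n - k * \<nu> - 1) choose (k - 1)) +
                 c\<^sub>1 * real ((n - k * \<nu> - 1) choose (k - 3))) \<and>
            (\<forall>\<^sub>F n in sequentially.
               real (max_cluster_free n k 4 \<nu>) \<le>
                 real ((n - k * \<nu> - 1) choose (k - 1)) +
                 c\<^sub>2 * real ((n - k * \<nu> - 1) choose (k - 3)))"
    unfolding a
  \<comment> \<open>The second constant is c + a, since c alone might lie below the required k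
    floor(nu^2/4); enlarging it keeps the upper bound.\<close>
  proof (rule exI[of _ "real a"], rule exI[of _ "real (c + a)"], intro conjI allI impI)
    fix n assume "k * (\<nu> + 1) \<le> n"
    from lower[OF this] show "real ((n - k * \<nu> - 1) choose (k - 1)) + real a * real ((n - k * \<nu> - 1) choose (k - 3))
        \<le> real (max_cluster_free n k 4 \<nu>)"
      by (simp only: of_nat_le_iff flip: of_nat_mult of_nat_add)
  next
    show "\<forall>\<^sub>F n in sequentially. real (max_cluster_free n k 4 \<nu>) \<le>
        real ((n - k * \<nu> - 1) choose (k - 1)) + real (c + a) * real ((n - k * \<nu> - 1) choose (k - 3))"
      using eventually_ge_at_top[of N] eventually_ge_at_top[of "k * (\<nu> + 1)"]
    proof eventually_elim
      case (elim n)
      from upper'[OF this] show ?case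
        by (simp only: of_nat_le_iff flip: of_nat_mult of_nat_add)
    qed
  qed simp_all
next
  fix n assume "2 * k \<le> n"
  then show "((n - k - 1) choose (k - 1)) + ex_tight_path (n - k - 1) 2 (k - 2) + 1 \<le> max_cluster_free n k 4 1"
    using max_cluster_free_one_ge[OF assms] by simp
qed

end
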